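(* Let $\{X_i(t): i\in\mathbb{Z}^d, t\in\mathbb{R}\}$ be the minimal stationary process of the interference queueing dynamics on $\mathbb{Z}^d$ with arrival intensity $\lambda$ and interference sequence $(a_j)_{j\in\mathbb{Z}^d}$ (see context). (1) For all $\lambda<\frac{1}{\sum_{j\in\mathbb{Z}^d}a_j}$, there exists a constant $c_0>0$ such that for all $c\in[0,c_0)$, all $i\in\mathbb{Z}^d$ and $t\in\mathbb{R}$, $$\mathbb{E}\left[e^{cX_i(t)}\right]<\infty .$$ (2) Moreover, for all $\lambda<\frac{1}{\sum_{j\in\mathbb{Z}^d}a_j}$, there exist constants $c_1,c_2,x_0>0$ such that for all $x\ge x_0$, $i\in\mathbb{Z}^d$ and $t\in\mathbb{R}$, $$e^{-c_1x}\le \mathbb{P}[X_i(t)\ge x]\le e^{-c_2x}.$$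
   Context: Model. Consider the $d$-dimensional grid $\mathbb{Z}^d$ and a sequence $(a_i)_{i\in\mathbb{Z}^d}$ (the interference sequence) with $a_i\ge0$, $a_i=a_{-i}$ for all $i$, $a_0=1$ and $\sum_{i\in\mathbb{Z}^d}a_i<\infty$ (infinitely many $a_i$ may be nonzero). Convention: $0/0=0$. $\mathbb{N}_0=\{0,1,2,\dots\}$. Let $\{\mathcal{A}_i\}_{i\in\mathbb{Z}^d}$ be independent Poisson point processes on $\mathbb{R}$ with intensity $\lambda$, and, independently, let $\{\mathcal{D}_i\}_{i\in\mathbb{Z}^d}$ be independent Poisson point processes of unit intensity on $\mathbb{R}\times[0,1]$. There is a queue at each $i\in\mathbb{Z}^d$, with queue length $X_i(t)\in\mathbb{N}_0$ at time $t$. An arrival ($X_i$ increases by 1) occurs at queue $i$ at each epoch of $\mathcal{A}_i$. At each atom $(t,u)$ of $\mathcal{D}_i$, a departure ($X_i$ decreases by 1) occurs from queue $i$ at time $t$ if and only if $u\le \frac{X_i(t)}{\sum_{j\in\mathbb{Z}^d}a_jX_{i-j}(t)}$ (queue lengths being those just before the potential departure). Thus, given the configuration, departures across queues are independent and queue $i$ has departures at rate $\frac{X_i(t)}{\sum_{j\in\mathbb{Z}^d}a_jX_{i-j}(t)}$. It is known that this process is well defined path-wise from the driving processes and is monotone: with the same driving processes, coordinate-wise ordered initial configurations almost surely remain coordinate-wise ordered for all later times. Minimal stationary process (Coupling-From-The-Past). For $t\ge0$ and $s\ge-t$ let $X_{i;t}(s)$ be the length of queue $i$ at time $s$ when the dynamics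 is started at time $-t$ with all queues empty, all these processes being built from the same $(\mathcal{A}_i,\mathcal{D}_i)_{i\in\mathbb{Z}^d}$. By monotonicity $t\mapsto X_{i;t}(s)$ is non-decreasing almost surely; set $X_{i;\infty}(s):=\lim_{t\to\infty}X_{i;t}(s)$. It is known that if $\lambda<1/\sum_{j\in\mathbb{Z}^d}a_j$, then $\{X_{i;\infty}(s)\}$ is a (finite, translation invariant) stationary solution of the dynamics, and it is minimal: any other stationary solution stochastically dominates it coordinate-wise for all time. The minimal stationary process is $X_i(t):=X_{i;\infty}(t)$, $i\in\mathbb{Z}^d$, $t\in\mathbb{R}$. *)

theory Defs
  imports "HOL-Probability.Probability"
begin

text \<open>
  The grid is the type \<^typ>\<open>int ^ 'd\<close> with \<^typ>\<open>'d::finite\<close>; its dimension is \<open>CARD('d)\<close>.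
\<close>

definition interference_sequence :: "(int ^ 'd::finite \<Rightarrow> real) \<Rightarrow> bool" where
  "interference_sequence a \<longleftrightarrow>
     (\<forall>i. a i \<ge> 0) \<and> (\<forall>i. a (- i) = a i) \<and> a 0 = 1 \<and> a summable_on UNIV"

text \<open>
  A point process is a random locally finite subset of \<^term>\<open>space \<mu>\<close>. Only diffuse intensity
  measures \<open>\<mu>\<close> that are finite on bounded sets are used below; the Poisson process is then simple,
  so nothing is lost by representing it as a set instead of a counting measure. The Poisson weights
  are written out because \<^const>\<open>poisson_pmf\<close> is unspecified at rate \<open>0\<close>, the case of null sets.
\<close>

definition poisson_point_process ::
    "'w measure \<Rightarrow> 'b::metric_space measure \<Rightarrow> ('w \<Rightarrow> 'b set) \<Rightarrow> bool" where
  "poisson_point_process M \<mu> P \<longleftrightarrow>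
     (\<forall>\<omega>\<in>space M. P \<omega> \<subseteq> space \<mu> \<and> (\<forall>B. bounded B \<longrightarrow> finite (P \<omega> \<inter> B))) \<and>
     (\<forall>B\<in>sets \<mu>. bounded B \<longrightarrow>
        (\<lambda>\<omega>. card (P \<omega> \<inter> B)) \<in> M \<rightarrow>\<^sub>M count_space UNIV \<and>
        (\<forall>k. measure M {\<omega> \<in> space M. card (P \<omega> \<inter> B) = k}
             = exp (- measure \<mu> B) * measure \<mu> B ^ k / fact k)) \<and>
     (\<forall>(n::nat) B. (\<forall>k<n. B k \<in> sets \<mu> \<and> bounded (B k)) \<and> disjoint_family_on B {..<n} \<longrightarrow>
        prob_space.indep_vars M (\<lambda>_. count_space UNIV) (\<lambda>k \<omega>. card (P \<omega> \<inter> B k)) {..<n})"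

definition point_process_events ::
    "'w measure \<Rightarrow> 'b::metric_space measure \<Rightarrow> ('w \<Rightarrow> 'b set) \<Rightarrow> 'w set set" where
  "point_process_events M \<mu> P =
     sigma_sets (space M)
       {{\<omega> \<in> space M. card (P \<omega> \<inter> B) = k} | B k. B \<in> sets \<mu> \<and> bounded B}"

definition arrival_intensity :: "real \<Rightarrow> real measure" where
  "arrival_intensity lam = scale_measure (ennreal lam) lborel"

definition departure_intensity :: "(real \<times> real) measure" where
  "departure_intensity = restrict_space lborel (UNIV \<times> {0..1})"

definition driving_processes ::
    "'w measure \<Rightarrow> real \<Rightarrow> (int ^ 'd::finite \<Rightarrow> 'w \<Rightarrow> real set) \<Rightarrow>
     (int ^ 'd \<Rightarrow> 'w \<Rightarrow> (real \<times> real) set) \<Rightarrow> bool" where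
  "driving_processes M lam A D \<longleftrightarrow>
     prob_space M \<and>
     (\<forall>i. poisson_point_process M (arrival_intensity lam) (A i)) \<and>
     (\<forall>i. poisson_point_process M departure_intensity (D i)) \<and>
     prob_space.indep_sets M
       (\<lambda>k. case k of
          Inl i \<Rightarrow> point_process_events M (arrival_intensity lam) (A i)
        | Inr i \<Rightarrow> point_process_events M departure_intensity (D i)) UNIV"

text \<open>
  The convention \<open>0/0 = 0\<close> is that of HOL. If the sum in the denominator diverges, the rate is
  \<open>0\<close>, because \<^const>\<open>infsum\<close> is then \<open>0\<close> as well.
\<close>

definition departure_rate ::
    "(int ^ 'd::finite \<Rightarrow> real) \<Rightarrow> (int ^ 'd \<Rightarrow> nat) \<Rightarrow> int ^ 'd \<Rightarrow> real" where
  "departure_rate a x i = real (x i) / (\<Sum>\<^sub>\<infinity>j. a j * real (x (i - j)))"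

definition left_limits :: "('i \<Rightarrow> real \<Rightarrow> nat) \<Rightarrow> real \<Rightarrow> 'i \<Rightarrow> nat" where
  "left_limits x \<tau> j = Lim (at_left \<tau>) (x j)"

text \<open>
  Path-wise dynamics after time \<open>t\<^sub>0\<close> for one realisation \<open>(A, D)\<close> of the driving processes, in
  integrated form: arrivals during \<open>(t\<^sub>0, s]\<close> increase, and accepted departure atoms during
  \<open>(t\<^sub>0, s]\<close> decrease the queue length. The values of \<open>x\<close> before time \<open>t\<^sub>0\<close> are irrelevant.
  For locally finite \<open>A\<close> and \<open>D\<close>, the equation makes every queue length a right-continuous step
  function on \<open>[t\<^sub>0, \<infinity>)\<close>, so that the left limits at \<open>\<tau> > t\<^sub>0\<close> exist.
\<close>

definition queue_dynamics ::
    "(int ^ 'd::finite \<Rightarrow> real) \<Rightarrow> (int ^ 'd \<Rightarrow> real set) \<Rightarrow> (int ^ 'd \<Rightarrow> (real \<times> real) set) \<Rightarrow>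
     real \<Rightarrow> (int ^ 'd \<Rightarrow> real \<Rightarrow> nat) \<Rightarrow> bool" where
  "queue_dynamics a A D t\<^sub>0 x \<longleftrightarrow>
     (\<forall>i. \<forall>s\<ge>t\<^sub>0.
        x i s + card {(\<tau>, u) \<in> D i. t\<^sub>0 < \<tau> \<and> \<tau> \<le> s \<and> u \<le> departure_rate a (left_limits x \<tau>) i}
        = x i t\<^sub>0 + card {\<tau> \<in> A i. t\<^sub>0 < \<tau> \<and> \<tau> \<le> s})"

text \<open>\<open>Y t i s\<close> is the length of queue \<open>i\<close> at time \<open>s \<ge> - t\<close> when starting empty at time \<open>- t\<close>.\<close>

definition started_empty ::
    "'w measure \<Rightarrow> (int ^ 'd::finite \<Rightarrow> real) \<Rightarrow> (int ^ 'd \<Rightarrow> 'w \<Rightarrow> real set) \<Rightarrow>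
     (int ^ 'd \<Rightarrow> 'w \<Rightarrow> (real \<times> real) set) \<Rightarrow> (real \<Rightarrow> int ^ 'd \<Rightarrow> real \<Rightarrow> 'w \<Rightarrow> nat) \<Rightarrow> bool" where
  "started_empty M a A D Y \<longleftrightarrow>
     (AE \<omega> in M. \<forall>t\<ge>0.
        (\<forall>i. Y t i (- t) \<omega> = 0) \<and>
        queue_dynamics a (\<lambda>i. A i \<omega>) (\<lambda>i. D i \<omega>) (- t) (\<lambda>i s. Y t i s \<omega>))"

text \<open>
  Coupling from the past. The limit is taken in \<^typ>\<open>enat\<close>, so finiteness of the limit is not
  presupposed.
\<close>

definition minimal_stationary_process ::
    "'w measure \<Rightarrow> (int ^ 'd::finite \<Rightarrow> real) \<Rightarrow> (int ^ 'd \<Rightarrow> 'w \<Rightarrow> real set) \<Rightarrow>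
     (int ^ 'd \<Rightarrow> 'w \<Rightarrow> (real \<times> real) set) \<Rightarrow> (int ^ 'd \<Rightarrow> real \<Rightarrow> 'w \<Rightarrow> enat) \<Rightarrow> bool" where
  "minimal_stationary_process M a A D X \<longleftrightarrow>
     (\<forall>i s. X i s \<in> M \<rightarrow>\<^sub>M count_space UNIV) \<and>
     (\<exists>Y. started_empty M a A D Y \<and>
        (AE \<omega> in M. \<forall>i s. ((\<lambda>t. enat (Y t i s \<omega>)) \<longlongrightarrow> X i s \<omega>) at_top))"

text \<open>The value at \<open>\<infinity>\<close> is \<open>\<infinity>\<close> even for \<open>c = 0\<close>, so a finite expectation always entails almost
  sure finiteness.\<close>

definition exp_enat :: "real \<Rightarrow> enat \<Rightarrow> ennreal" where
  "exp_enat c n = (case n of enat k \<Rightarrow> ennreal (exp (c * real k)) | \<infinity> \<Rightarrow> \<infinity>)"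

end

theory Submission
  imports Defs
begin

text \<open>
  Upper tail: fix a small step \<open>\<delta>\<close> and let \<open>W\<close> be the discrete-time chain that, on each step of a time
  grid, adds all arrivals \<open>N\<close> and performs at most one departure from queue \<open>i\<close>, namely if some
  departure mark of the step is at most \<open>W\<^sub>i / (\<Sum>j. a\<^sub>j (W + N)\<^bsub>i-j\<^esub>)\<close>. Every path-wise solution started empty
  lies below \<open>W\<close> on the grid. The chain is driven by independent variables whose laws do not depend on the site, so
  its one-site laws do not depend on the site either. With \<open>\<kappa> = 1 / \<Sum>j. a\<^sub>j\<close>, combine \<open>1/y \<ge> 2\<kappa> - \<kappa>\<^sup>2 y\<close>
  with the convexity inequality \<open>u x \<cdot> y \<le> x \<cdot> u x + U y - U x\<close> for the nondecreasing weight
  \<open>u x = exp (c x) / x\<close> (cut off at small \<open>x\<close>) and its primitive \<open>U\<close>: by homogeneity \<open>E (U W\<^sub>j) = E (U W\<^sub>i)\<close>,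
  so these terms cancel and \<open>E (exp (c W))\<close> contracts in one step, up to a constant, as soon as
  \<open>\<lambda> exp c < \<kappa>\<close> and \<open>\<delta>\<close> is small. Fatou's lemma along starting times \<open>s - k \<delta>\<close> carries the bound over
  to the stationary process.

  Lower tail: \<open>n\<close> arrivals and no departure atom during a period of length \<open>n / \<lambda>\<close> have probability at
  least \<open>exp (- n - n / \<lambda>)\<close>. A period of bounded length would only give the Poisson tail
  \<open>exp (- O (n ln n))\<close>.
\<close>

section \<open>Path-wise comparison with the discrete-time chain\<close>

text \<open>The integrated equation can be restarted at any later time \<open>s\<close>, because
  arrivals and accepted departures count additively over adjacent half-open intervals. Local
  finiteness enters since \<open>card\<close> is \<open>0\<close> on infinite sets.\<close>

lemma queue_dynamics_increment:
  assumes dyn: "queue_dynamics a A D t\<^sub>0 x"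
    and finA: "\<And>B. bounded B \<Longrightarrow> finite (A i \<inter> B)"
    and finD: "\<And>B. bounded B \<Longrightarrow> finite (D i \<inter> B)"
    and subD: "D i \<subseteq> UNIV \<times> {0..1}"
    and s: "t\<^sub>0 \<le> s" "s \<le> s'"
  shows "x i s' + card {(\<tau>, u) \<in> D i. s < \<tau> \<and> \<tau> \<le> s' \<and> u \<le> departure_rate a (left_limits x \<tau>) i}
       = x i s + card {\<tau> \<in> A i. s < \<tau> \<and> \<tau> \<le> s'}"
proof -
  let ?r = "\<lambda>\<tau>. departure_rate a (left_limits x \<tau>) i"
  let ?D = "\<lambda>p q. {(\<tau>, u) \<in> D i. p < \<tau> \<and> \<tau> \<le> q \<and> u \<le> ?r \<tau>}"
  let ?A = "\<lambda>p q. {\<tau> \<in> A i. p < \<tau> \<and> \<tau> \<le> q}"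
  have fD: "finite (?D p q)" for p q
  proof -
    have "bounded ({p..q} \<times> {0..1::real})"
      by (intro bounded_Times bounded_closed_interval)
    from finD[OF this] show ?thesis
      by (rule rev_finite_subset) (use subD in auto)
  qed
  have fA: "finite (?A p q)" for p q
    using finA[OF bounded_closed_interval, of p q] by (rule rev_finite_subset) auto
  have "?D t\<^sub>0 s' = ?D t\<^sub>0 s \<union> ?D s s'" "?A t\<^sub>0 s' = ?A t\<^sub>0 s \<union> ?A s s'"
    using s by auto
  moreover have "?D t\<^sub>0 s \<inter> ?D s s' = {}" "?A t\<^sub>0 s \<inter> ?A s s' = {}"
    by auto
  ultimately have "card (?D t\<^sub>0 s') = card (?D t\<^sub>0 s) + card (?D s s')"
      "card (?A t\<^sub>0 s') = card (?A t\<^sub>0 s) + card (?A s s')"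
    by (simp_all only: card_Un_disjoint[OF fD fD] card_Un_disjoint[OF fA fA])
  moreover have "x i s' + card (?D t\<^sub>0 s') = x i t\<^sub>0 + card (?A t\<^sub>0 s')"
    "x i s + card (?D t\<^sub>0 s) = x i t\<^sub>0 + card (?A t\<^sub>0 s)"
    using dyn[unfolded queue_dynamics_def, rule_format, of s' i]
      dyn[unfolded queue_dynamics_def, rule_format, of s i] s by simp_all
  ultimately show ?thesis by linarith
qed

text \<open>\<open>Lim\<close> carries information only where a limit exists. Only finitely many
  atoms lie near \<tau>, so queue \<open>i\<close> is constant on an interval ending at \<tau>, and
  that constant is the left limit.\<close>

lemma queue_dynamics_left_limit:
  assumes dyn: "queue_dynamics a A D t\<^sub>0 x"
    and finA: "\<And>B. bounded B \<Longrightarrow> finite (A i \<inter> B)"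
    and finD: "\<And>B. bounded B \<Longrightarrow> finite (D i \<inter> B)"
    and subD: "D i \<subseteq> UNIV \<times> {0..1}"
    and \<tau>: "t\<^sub>0 < \<tau>"
  shows "eventually (\<lambda>s. x i s = left_limits x \<tau> i) (at_left \<tau>)"
proof -
  \<comment> \<open>All possible jump times up to \<tau>, whether or not the departure is accepted.
    The time \<tau> itself is removed, as a jump there does not affect the left limit.\<close>
  define E where "E = (A i \<inter> {t\<^sub>0..\<tau>} \<union> fst ` (D i \<inter> {t\<^sub>0..\<tau>} \<times> {0..1})) - {\<tau>}"
  have "finite E"
    unfolding E_def
    by (intro finite_Diff finite_UnI finite_imageI finA finD bounded_Times bounded_closed_interval)
  define \<sigma> where "\<sigma> = Max (insert t\<^sub>0 E)"
  have \<sigma>: "t\<^sub>0 \<le> \<sigma>" "\<sigma> < \<tau>" "\<And>e. e \<in> E \<Longrightarrow> e \<le> \<sigma>"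
    using \<open>finite E\<close> \<tau> unfolding \<sigma>_def by (auto simp: E_def)
  have const: "x i s = x i \<sigma>" if "\<sigma> < s" "s < \<tau>" for s
  proof -
    have "{(\<tau>, u) \<in> D i. \<sigma> < \<tau> \<and> \<tau> \<le> s \<and> u \<le> departure_rate a (left_limits x \<tau>) i} = {}"
    proof (intro equals0I, clarify)
      fix \<tau>' u assume *: "(\<tau>', u) \<in> D i" "\<sigma> < \<tau>'" "\<tau>' \<le> s"
      then have "(\<tau>', u) \<in> D i \<inter> {t\<^sub>0..\<tau>} \<times> {0..1}"
        using subD that \<sigma> by auto
      then have "\<tau>' \<in> E" using that * unfolding E_def by (force simp: image_iff)
      with \<sigma>(3) * show False by force
    qed
    moreover have "{\<tau> \<in> A i. \<sigma> < \<tau> \<and> \<tau> \<le> s} = {}"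
      using \<sigma> that unfolding E_def by force
    moreover have "x i s + card {(\<tau>, u) \<in> D i. \<sigma> < \<tau> \<and> \<tau> \<le> s \<and> u \<le> departure_rate a (left_limits x \<tau>) i}
        = x i \<sigma> + card {\<tau> \<in> A i. \<sigma> < \<tau> \<and> \<tau> \<le> s}"
      by (rule queue_dynamics_increment[OF dyn finA finD subD \<sigma>(1)]) (use that in auto)
    ultimately show ?thesis by (simp only: card.empty)
  qed
  have ev: "eventually (\<lambda>s. x i s = x i \<sigma>) (at_left \<tau>)"
    using \<sigma>(2) const by (auto simp: eventually_at_left_field)
  then have "(x i \<longlongrightarrow> x i \<sigma>) (at_left \<tau>)"
    by (rule tendsto_eventually)
  then have "left_limits x \<tau> i = x i \<sigma>"
    unfolding left_limits_def by (intro tendsto_Lim) auto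
  with ev show ?thesis by simp
qed

text \<open>A lower bound for the departure rate at \<open>i\<close> in every configuration with at
  least \<open>w i\<close> customers at \<open>i\<close> and at most \<open>w + n\<close>
  everywhere: the numerator ignores the arrivals of the step, the denominator counts all of
  them.\<close>

definition step_threshold ::
    "(int ^ 'd::finite \<Rightarrow> real) \<Rightarrow> (int ^ 'd \<Rightarrow> nat) \<Rightarrow> (int ^ 'd \<Rightarrow> nat) \<Rightarrow> int ^ 'd \<Rightarrow> real" where
  "step_threshold a w n i = real (w i) / (\<Sum>\<^sub>\<infinity>j. a j * real (w (i - j) + n (i - j)))"

text \<open>A positive threshold forces \<open>w i > 0\<close>, so the subtraction of naturals is
  never truncated. The guard also rules out a departure when the denominator diverges, where
  \<open>infsum\<close> and hence the threshold are \<open>0\<close>.\<close>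

definition dominating_step ::
    "(int ^ 'd::finite \<Rightarrow> real) \<Rightarrow> (int ^ 'd \<Rightarrow> nat) \<Rightarrow> (int ^ 'd \<Rightarrow> nat) \<Rightarrow> (int ^ 'd \<Rightarrow> real) \<Rightarrow>
     int ^ 'd \<Rightarrow> nat" where
  "dominating_step a w n u i =
     w i + n i - (if 0 < step_threshold a w n i \<and> u i \<le> step_threshold a w n i then 1 else 0)"

lemma infsum_pos_imp_summable:
  fixes f :: "'a \<Rightarrow> real"
  assumes "0 < infsum f S"
  shows "f summable_on S"
  using assms infsum_not_exists by fastforce

text \<open>Without a departure in the chain, counting arrivals suffices. With one, the critical
  case is \<open>x i s = w i\<close> and no accepted departure: then queue \<open>i\<close> stays at
  least \<open>w i\<close> and all queues stay at most \<open>w + n\<close>, so the true rate at the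
  atom supplied by \<open>u\<close> is at least the threshold and that atom would have been
  accepted.\<close>

lemma dominating_step_dominates:
  assumes a: "\<And>j. 0 \<le> a j" "a 0 = 1"
    and dyn: "queue_dynamics a A D t\<^sub>0 x"
    and finA: "\<And>i B. bounded B \<Longrightarrow> finite (A i \<inter> B)"
    and finD: "\<And>i B. bounded B \<Longrightarrow> finite (D i \<inter> B)"
    and subD: "\<And>i. D i \<subseteq> UNIV \<times> {0..1}"
    and s: "t\<^sub>0 \<le> s" "s \<le> s'"
    and le: "\<And>j. x j s \<le> w j"
    and n: "\<And>j. n j = card (A j \<inter> {s<..s'})"
    and u: "\<And>\<rho>. 0 < \<rho> \<Longrightarrow> \<rho> \<le> 1 \<Longrightarrow> u i \<le> \<rho> \<Longrightarrow> \<exists>\<tau> v. (\<tau>, v) \<in> D i \<and> s < \<tau> \<and> \<tau> \<le> s' \<and> v \<le> \<rho>"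
  shows "x i s' \<le> dominating_step a w n u i"
proof -
  let ?acc = "\<lambda>i p q. {(\<tau>, u) \<in> D i. p < \<tau> \<and> \<tau> \<le> q \<and> u \<le> departure_rate a (left_limits x \<tau>) i}"
  let ?arr = "\<lambda>i p q. {\<tau> \<in> A i. p < \<tau> \<and> \<tau> \<le> q}"
  have fin_arr: "finite (?arr j p q)" for j p q
    using finA[OF bounded_closed_interval, of j p q] by (rule rev_finite_subset) auto
  have fin_acc: "finite (?acc j p q)" for j p q
  proof -
    have "bounded ({p..q} \<times> {0..1::real})"
      by (intro bounded_Times bounded_closed_interval)
    from finD[OF this] show ?thesis
      by (rule rev_finite_subset) (use subD in auto)
  qed
  have n': "n j = card (?arr j s s')" for j
    unfolding n by (rule arg_cong[of _ _ card]) auto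
  have inc: "x j q + card (?acc j s q) = x j s + card (?arr j s q)" if "s \<le> q" for j q
    by (rule queue_dynamics_increment[OF dyn finA finD subD s(1) that])
  have arr_le: "card (?arr j s q) \<le> n j" if "q \<le> s'" for j q
    unfolding n' by (rule card_mono[OF fin_arr]) (use that in auto)
  have up: "x j q \<le> w j + n j" if "s \<le> q" "q \<le> s'" for j q
    using inc[OF that(1), of j] arr_le[OF that(2), of j] le[of j] by linarith
  show ?thesis
  proof (cases "0 < step_threshold a w n i \<and> u i \<le> step_threshold a w n i")
    case False
    then show ?thesis using up[of s' i] s by (simp only: dominating_step_def) simp
  next
    case True
    define \<rho> where "\<rho> = step_threshold a w n i"
    define f where "f j = a j * real (w (i - j) + n (i - j))" for j
    have \<rho>: "\<rho> = real (w i) / infsum f UNIV"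
      unfolding \<rho>_def step_threshold_def f_def by simp
    have "0 < \<rho>" "u i \<le> \<rho>" using True by (auto simp: \<rho>_def)
    have f0: "0 \<le> f j" for j using a by (simp add: f_def)
    have "0 \<le> infsum f UNIV" by (rule infsum_nonneg) (use f0 in auto)
    then have pos: "0 < infsum f UNIV" "0 < w i"
      using \<open>0 < \<rho>\<close> unfolding \<rho> by (auto simp: zero_less_divide_iff)
    then have sumf: "f summable_on UNIV" by (intro infsum_pos_imp_summable)
    \<comment> \<open>The term \<open>j = 0\<close>, with \<open>a 0 = 1\<close>, keeps the
      threshold at most \<open>1\<close>, within the range of the marks.\<close>
    have "f 0 \<le> infsum f UNIV"
      using finite_sum_le_infsum[OF sumf, of "{0}"] f0 by auto
    then have "real (w i) \<le> infsum f UNIV" using a by (simp add: f_def)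
    then have "\<rho> \<le> 1" using pos by (simp add: \<rho>)
    then obtain \<tau> v where \<tau>: "(\<tau>, v) \<in> D i" "s < \<tau>" "\<tau> \<le> s'" "v \<le> \<rho>"
      using u \<open>0 < \<rho>\<close> \<open>u i \<le> \<rho>\<close> by blast
    have "x i s' + 1 \<le> w i + n i"
    proof (cases "x i s < w i \<or> card (?acc i s s') \<noteq> 0")
      case True
      then show ?thesis using inc[OF s(2), of i] le[of i] n'[of i] by linarith
    next
      case False
      then have eq: "x i s = w i" and none: "?acc i s s' = {}"
        using le[of i] card_0_eq[OF fin_acc[of i s s']] by linarith+
      let ?l = "left_limits x \<tau>"
      have near: "eventually (\<lambda>q. s < q \<and> q < \<tau>) (at_left \<tau>)"
        using \<tau> by (auto simp: eventually_at_left_field)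
      have l: "\<exists>q. s < q \<and> q < \<tau> \<and> x j q = ?l j" for j
      proof -
        have "eventually (\<lambda>q. x j q = ?l j) (at_left \<tau>)"
          by (rule queue_dynamics_left_limit[OF dyn finA finD subD]) (use s \<tau> in auto)
        from eventually_happens'[OF _ eventually_conj[OF near this]] show ?thesis by auto
      qed
      have l_up: "?l j \<le> w j + n j" for j
      proof -
        obtain q where q: "s < q" "q < \<tau>" "x j q = ?l j" using l by blast
        then show ?thesis using up[of q j] \<tau> by simp
      qed
      \<comment> \<open>With no accepted departure in the step, queue \<open>i\<close> can only grow
        from \<open>x i s = w i\<close>.\<close>
      have l_lo: "w i \<le> ?l i"
      proof -
        obtain q where q: "s < q" "q < \<tau>" "x i q = ?l i" using l by blast
        have "?acc i s q \<subseteq> ?acc i s s'" using q \<tau> by auto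
        then have "?acc i s q = {}" using none by blast
        then have "card (?acc i s q) = 0" by (simp only: card.empty)
        then show ?thesis using inc[of q i] q eq by linarith
      qed
      define g where "g j = a j * real (?l (i - j))" for j
      have g0: "0 \<le> g j" for j using a by (simp add: g_def)
      have gf: "g j \<le> f j" for j unfolding g_def f_def
        by (intro mult_left_mono) (use a l_up in \<open>auto simp flip: of_nat_add\<close>)
      \<comment> \<open>Summability matters: a divergent denominator would make the rate
        \<open>0\<close> by default.\<close>
      have sumg: "g summable_on UNIV"
        by (rule summable_on_comparison_test[OF sumf]) (use gf g0 in auto)
      have "infsum g UNIV \<le> infsum f UNIV"
        by (rule infsum_mono[OF sumg sumf]) (rule gf)
      moreover have "g 0 \<le> infsum g UNIV"
        using finite_sum_le_infsum[OF sumg, of "{0}"] g0 by auto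
      moreover have "g 0 = real (?l i)" using a by (simp add: g_def)
      ultimately have "\<rho> \<le> real (?l i) / infsum g UNIV"
        unfolding \<rho> using l_lo pos by (intro frac_le) auto
      then have "v \<le> departure_rate a ?l i"
        using \<tau> unfolding departure_rate_def g_def by simp
      then have "(\<tau>, v) \<in> ?acc i s s'" using \<tau> by auto
      with none show ?thesis by blast
    qed
    then show ?thesis using True by (simp add: dominating_step_def)
  qed
qed

section \<open>Independence of the grid variables\<close>

text \<open>Two levels of independence combine. A finite index set is split by first components; the
  probability factors across the blocks, since each block event lies in \<open>F k\<close>, and then
  inside every block.\<close>

lemma (in prob_space) indep_vars_blocks:
  fixes X :: "'k \<times> 'l \<Rightarrow> 'a \<Rightarrow> 'b"
  assumes F: "indep_sets F UNIV"
    and sig: "\<And>k. sigma_algebra (space M) (F k)"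
    and meas: "\<And>k l. X (k, l) \<in> sigma (space M) (F k) \<rightarrow>\<^sub>M N"
    and ind: "\<And>k. indep_vars (\<lambda>_. N) (\<lambda>l. X (k, l)) UNIV"
  shows "indep_vars (\<lambda>_. N) X UNIV"
  unfolding indep_vars_def2
proof (intro conjI ballI)
  fix p :: "'k \<times> 'l"
  show rv: "random_variable N (X p)"
    using ind[of "fst p"] unfolding indep_vars_def2 by (cases p) auto
next
  have rv: "random_variable N (X p)" for p
    using ind[of "fst p"] unfolding indep_vars_def2 by (cases p) auto
  show "indep_sets (\<lambda>p. {X p -` A \<inter> space M |A. A \<in> sets N}) UNIV"
  proof (rule indep_setsI)
    show "{X p -` A \<inter> space M |A. A \<in> sets N} \<subseteq> events" for p
      using rv[of p] by (auto intro: measurable_sets)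
  next
    fix A :: "'k \<times> 'l \<Rightarrow> 'a set" and J :: "('k \<times> 'l) set"
    assume J: "J \<noteq> {}" "J \<subseteq> UNIV" "finite J"
      and A: "\<forall>j\<in>J. A j \<in> {X j -` A \<inter> space M |A. A \<in> sets N}"
    define K where "K = fst ` J"
    define L where "L k = {l. (k, l) \<in> J}" for k
    have JS: "J = Sigma K L" by (force simp: K_def L_def)
    have fin: "finite K" "finite (L k)" for k
      unfolding K_def L_def using finite_vimageI[OF J(3), of "Pair k"] J(3)
      by (auto simp: inj_on_def vimage_def)
    have ne: "K \<noteq> {}" "k \<in> K \<Longrightarrow> L k \<noteq> {}" for k
      using J unfolding K_def L_def by auto
    have AF: "A (k, l) \<in> F k" if "k \<in> K" "l \<in> L k" for k l
    proof -
      have "(k, l) \<in> J" using that by (simp add: JS)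
      then obtain B where B: "B \<in> sets N" "A (k, l) = X (k, l) -` B \<inter> space M"
        using A by blast
      have "X (k, l) -` B \<inter> space (sigma (space M) (F k)) \<in> sets (sigma (space M) (F k))"
        using meas B(1) by (rule measurable_sets)
      moreover have "F k \<subseteq> Pow (space M)"
        using sig[of k] by (simp add: sigma_algebra_iff2)
      ultimately show ?thesis
        using B(2) sigma_algebra.sets_measure_of_eq[OF sig[of k]] by (simp add: space_measure_of)
    qed
    have inner: "prob (\<Inter>l\<in>L k. A (k, l)) = (\<Prod>l\<in>L k. prob (A (k, l)))" if "k \<in> K" for k
    proof (rule indep_setsD)
      show "indep_sets (\<lambda>l. {X (k, l) -` A \<inter> space M |A. A \<in> sets N}) UNIV"
        using ind[of k] unfolding indep_vars_def2 by auto
    qed (use ne that fin A JS in auto)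
    have "(\<Inter>j\<in>J. A j) = (\<Inter>k\<in>K. \<Inter>l\<in>L k. A (k, l))"
      unfolding JS by auto
    also have "prob \<dots> = (\<Prod>k\<in>K. prob (\<Inter>l\<in>L k. A (k, l)))"
    proof (rule indep_setsD[OF F])
      show "\<forall>k\<in>K. (\<Inter>l\<in>L k. A (k, l)) \<in> F k"
      proof
        fix k assume "k \<in> K"
        then show "(\<Inter>l\<in>L k. A (k, l)) \<in> F k"
          using sigma_algebra.countable_INT'[OF sig[of k] countable_finite[OF fin(2)[of k]], of "\<lambda>l. A (k, l)"]
            ne AF by auto
      qed
    qed (use ne fin in auto)
    also have "\<dots> = (\<Prod>k\<in>K. \<Prod>l\<in>L k. prob (A (k, l)))"
      using inner by simp
    also have "\<dots> = (\<Prod>j\<in>J. prob (A j))"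
      unfolding JS using fin by (subst prod.Sigma) (auto simp: case_prod_beta)
    finally show "prob (\<Inter>j\<in>J. A j) = (\<Prod>j\<in>J. prob (A j))" .
  qed
qed

text \<open>The Poisson definition speaks about families indexed by \<open>{..<n}\<close>. Every
  finite set of indices lies in such a segment, and independence is a property of finite
  subfamilies.\<close>

lemma (in prob_space) indep_vars_nat_UNIV:
  assumes "\<And>n::nat. indep_vars N X {..<n}"
  shows "indep_vars N X UNIV"
proof -
  have "random_variable (N i) (X i)" for i
    using assms[of "Suc i"] unfolding indep_vars_def2 by auto
  moreover have "indep_sets (\<lambda>i. {X i -` A \<inter> space M |A. A \<in> sets (N i)}) UNIV"
  proof (subst indep_sets_finite_index_sets, intro allI impI)
    fix J :: "nat set" assume "finite J"
    then have "J \<subseteq> {..<Suc (Max J)}" by (auto simp: less_Suc_eq_le)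
    then show "indep_sets (\<lambda>i. {X i -` A \<inter> space M |A. A \<in> sets (N i)}) J"
      using assms[of "Suc (Max J)"] unfolding indep_vars_def2
      by (auto intro: indep_sets_mono_index)
  qed
  ultimately show ?thesis unfolding indep_vars_def2 by auto
qed

text \<open>Upper half-lines are closed under intersection and generate the Borel sets, so
  factorisation on them is enough. For smallest marks these are the events whose probabilities the
  Poisson process gives.\<close>

lemma (in prob_space) indep_vars_greaterThanI:
  fixes U :: "'i \<Rightarrow> 'a \<Rightarrow> real"
  assumes rv: "\<And>i. random_variable borel (U i)"
    and ind: "\<And>J x. finite J \<Longrightarrow> J \<noteq> {} \<Longrightarrow>
      prob (\<Inter>j\<in>J. {\<omega> \<in> space M. x j < U j \<omega>}) = (\<Prod>j\<in>J. prob {\<omega> \<in> space M. x j < U j \<omega>})"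
  shows "indep_vars (\<lambda>_. borel) U UNIV"
  unfolding indep_vars_def2
proof (intro conjI ballI rv)
  let ?G = "\<lambda>i. range (\<lambda>x. {\<omega> \<in> space M. x < U i \<omega>})"
  have "indep_sets ?G UNIV"
  proof (rule indep_setsI)
    show "?G i \<subseteq> events" for i
      using rv[of i] by auto
  next
    fix A J assume J: "J \<noteq> {}" "finite J" and A: "\<forall>j\<in>J. A j \<in> ?G j"
    then obtain x where x: "\<And>j. j \<in> J \<Longrightarrow> A j = {\<omega> \<in> space M. x j < U j \<omega>}"
      by (auto simp: image_iff) metis
    have "(\<Inter>j\<in>J. A j) = (\<Inter>j\<in>J. {\<omega> \<in> space M. x j < U j \<omega>})" using x by (intro INF_cong) auto
    also have "prob \<dots> = (\<Prod>j\<in>J. prob {\<omega> \<in> space M. x j < U j \<omega>})"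
      by (rule ind[OF J(2,1)])
    also have "\<dots> = (\<Prod>j\<in>J. prob (A j))"
      by (intro prod.cong refl) (simp add: x)
    finally show "prob (\<Inter>j\<in>J. A j) = (\<Prod>j\<in>J. prob (A j))" .
  qed
  then have "indep_sets (\<lambda>i. sigma_sets (space M) (?G i)) UNIV"
  proof (rule indep_sets_sigma)
    have "{\<omega> \<in> space M. x < U i \<omega>} \<inter> {\<omega> \<in> space M. y < U i \<omega>} = {\<omega> \<in> space M. max x y < U i \<omega>}" for i x y
      by auto
    then show "Int_stable (?G i)" for i
      unfolding Int_stable_def by blast
  qed
  then show "indep_sets (\<lambda>i. {U i -` A \<inter> space M |A. A \<in> sets borel}) UNIV"
  proof (rule indep_sets_mono_sets)
    fix i
    have sub: "?G i \<subseteq> Pow (space M)" by auto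
    have "U i \<in> borel_measurable (sigma (space M) (?G i))"
      by (rule borel_measurableI_greater) (auto simp: space_measure_of sub sets_measure_of)
    from measurable_sets[OF this] show "{U i -` A \<inter> space M |A. A \<in> sets borel} \<subseteq> sigma_sets (space M) (?G i)"
      by (auto simp: space_measure_of sub sets_measure_of)
  qed
qed

text \<open>The value \<open>2\<close> stands for an empty set of marks; marks and thresholds are at most \<open>1\<close>.\<close>

definition min_mark :: "(real \<times> real) set \<Rightarrow> real \<Rightarrow> real \<Rightarrow> real" where
  "min_mark P s s' = Min (insert 2 (snd ` (P \<inter> {s<..s'} \<times> {0..1})))"

text \<open>The law and the independence of the smallest mark thereby reduce to void probabilities
  of rectangles. For \<open>x < 0\<close> the rectangle is empty; the condition \<open>x < 2\<close>
  reflects the default value.\<close>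

lemma less_min_mark_iff:
  assumes "finite (P \<inter> {s<..s'} \<times> {0..1})"
  shows "x < min_mark P s s' \<longleftrightarrow> x < 2 \<and> card (P \<inter> {s<..s'} \<times> {0..min x 1}) = 0"
proof -
  have "finite (P \<inter> {s<..s'} \<times> {0..min x 1})"
    by (rule finite_subset[OF _ assms]) auto
  then have "card (P \<inter> {s<..s'} \<times> {0..min x 1}) = 0 \<longleftrightarrow> P \<inter> {s<..s'} \<times> {0..min x 1} = {}"
    by simp
  moreover have "x < min_mark P s s' \<longleftrightarrow> x < 2 \<and> (\<forall>p\<in>P \<inter> {s<..s'} \<times> {0..1}. x < snd p)"
    unfolding min_mark_def by (subst Min_gr_iff) (use assms in auto)
  moreover have "(\<forall>p\<in>P \<inter> {s<..s'} \<times> {0..1}. x < snd p) \<longleftrightarrow> P \<inter> {s<..s'} \<times> {0..min x 1} = {}"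
  proof
    show "P \<inter> {s<..s'} \<times> {0..min x 1} = {}" if "\<forall>p\<in>P \<inter> {s<..s'} \<times> {0..1}. x < snd p"
    proof (rule equals0I)
      fix p assume p: "p \<in> P \<inter> {s<..s'} \<times> {0..min x 1}"
      then have "p \<in> P \<inter> {s<..s'} \<times> {0..1}" by auto
      with that have "x < snd p" by blast
      moreover have "snd p \<le> x" using p by auto
      ultimately show False by linarith
    qed
    show "\<forall>p\<in>P \<inter> {s<..s'} \<times> {0..1}. x < snd p" if e: "P \<inter> {s<..s'} \<times> {0..min x 1} = {}"
    proof (rule ballI, rule ccontr)
      fix p assume "p \<in> P \<inter> {s<..s'} \<times> {0..1}" "\<not> x < snd p"
      then have "p \<in> P \<inter> {s<..s'} \<times> {0..min x 1}" by auto
      with e show False by blast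
    qed
  qed
  ultimately show ?thesis by simp
qed

section \<open>Poisson counts on intervals and rectangles\<close>

lemma measure_arrival_intensity:
  assumes "0 \<le> lam" "s \<le> s'"
  shows "measure (arrival_intensity lam) {s<..s'} = lam * (s' - s)"
  using assms unfolding arrival_intensity_def measure_def
  by (simp add: emeasure_scale_measure flip: ennreal_mult)

text \<open>\<open>max 0 r\<close> covers negative \<open>r\<close>, where the rectangle is empty;
  such values occur because the level \<open>x\<close> in \<open>less_min_mark_iff\<close> is an
  arbitrary real.\<close>

lemma measure_departure_intensity:
  assumes "s \<le> s'" "r \<le> 1"
  shows "{s<..s'} \<times> {0..r} \<in> sets departure_intensity"
    and "measure departure_intensity ({s<..s'} \<times> {0..r}) = (s' - s) * max 0 r"
proof -
  have *: "{s<..s'} \<times> {0..r} \<in> sets lborel" "UNIV \<times> {0..1::real} \<in> sets (lborel :: (real \<times> real) measure)"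
    by (simp_all add: borel_prod[symmetric])
  show "{s<..s'} \<times> {0..r} \<in> sets departure_intensity"
    using * assms unfolding departure_intensity_def
    by (subst sets_restrict_space_iff) auto
  have "measure departure_intensity ({s<..s'} \<times> {0..r}) = measure lborel ({s<..s'} \<times> {0..r})"
    unfolding departure_intensity_def by (rule measure_restrict_space) (use * assms in auto)
  also have "\<dots> = measure lborel {s<..s'} * measure lborel {0..r}"
    unfolding lborel_prod[symmetric] measure_def
    by (subst lborel.emeasure_pair_measure_Times) (auto simp: enn2real_mult)
  also have "\<dots> = (s' - s) * max 0 r"
    using assms by (auto simp: max_def)
  finally show "measure departure_intensity ({s<..s'} \<times> {0..r}) = (s' - s) * max 0 r" .
qed


lemma poisson_point_process_prob_card:
  assumes "poisson_point_process M \<mu> P" "B \<in> sets \<mu>" "bounded B"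
  shows "(\<lambda>\<omega>. card (P \<omega> \<inter> B)) \<in> M \<rightarrow>\<^sub>M count_space UNIV"
    and "measure M {\<omega> \<in> space M. card (P \<omega> \<inter> B) = k}
      = exp (- measure \<mu> B) * measure \<mu> B ^ k / fact k"
  using assms unfolding poisson_point_process_def by blast+

lemma poisson_point_process_locally_finite:
  assumes "poisson_point_process M \<mu> P" "\<omega> \<in> space M"
  shows "P \<omega> \<subseteq> space \<mu>" and "bounded B \<Longrightarrow> finite (P \<omega> \<inter> B)"
  using assms unfolding poisson_point_process_def by auto

lemma poisson_point_process_indep:
  assumes "poisson_point_process M \<mu> P" "\<And>k. B k \<in> sets \<mu>" "\<And>k. bounded (B k)"
    and "disjoint_family_on B {..<n::nat}"
  shows "prob_space.indep_vars M (\<lambda>_. count_space UNIV) (\<lambda>k \<omega>. card (P \<omega> \<inter> B k)) {..<n}"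
proof -
  have "\<forall>(n::nat) B. (\<forall>k<n. B k \<in> sets \<mu> \<and> bounded (B k)) \<and> disjoint_family_on B {..<n} \<longrightarrow>
        prob_space.indep_vars M (\<lambda>_. count_space UNIV) (\<lambda>k \<omega>. card (P \<omega> \<inter> B k)) {..<n}"
    using assms(1) unfolding poisson_point_process_def by (elim conjE)
  from this[rule_format, of n B] assms show ?thesis by simp
qed

lemma (in prob_space) distr_card_poisson:
  assumes P: "poisson_point_process M \<mu> P" "B \<in> sets \<mu>" "bounded B" "0 < measure \<mu> B"
  shows "distr M (count_space UNIV) (\<lambda>\<omega>. card (P \<omega> \<inter> B)) = measure_pmf (poisson_pmf (measure \<mu> B))"
proof (rule measure_eqI_countable)
  fix k :: nat
  note * = poisson_point_process_prob_card[OF P(1-3)]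
  have "emeasure (distr M (count_space UNIV) (\<lambda>\<omega>. card (P \<omega> \<inter> B))) {k}
      = ennreal (prob {\<omega> \<in> space M. card (P \<omega> \<inter> B) = k})"
    using *(1) by (subst emeasure_distr) (auto simp: emeasure_eq_measure vimage_def Int_def intro!: arg_cong[of _ _ prob])
  then show "emeasure (distr M (count_space UNIV) (\<lambda>\<omega>. card (P \<omega> \<inter> B))) {k}
      = emeasure (measure_pmf (poisson_pmf (measure \<mu> B))) {k}"
    using P(4) by (simp add: *(2) emeasure_pmf_single)
qed auto

lemma point_process_events_sigma_algebra:
  "sigma_algebra (space M) (point_process_events M \<mu> P)"
  unfolding point_process_events_def by (rule sigma_algebra_sigma_sets) auto

lemma sets_sigma_point_process_events:
  "sets (sigma (space M) (point_process_events M \<mu> P)) = point_process_events M \<mu> P"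
  by (rule sigma_algebra.sets_measure_of_eq[OF point_process_events_sigma_algebra])

lemma space_sigma_point_process_events:
  "space (sigma (space M) (point_process_events M \<mu> P)) = space M"
  by (rule space_measure_of)
    (use point_process_events_sigma_algebra[of M \<mu> P] in \<open>auto simp: sigma_algebra_iff2\<close>)

text \<open>Measurability with respect to the events of the single process, rather than to
  \<open>M\<close>, is what the independence across sites and process types refers to.\<close>

lemma card_measurable_point_process_events:
  assumes "B \<in> sets \<mu>" "bounded B"
  shows "(\<lambda>\<omega>. card (P \<omega> \<inter> B)) \<in> sigma (space M) (point_process_events M \<mu> P) \<rightarrow>\<^sub>M count_space UNIV"
  unfolding measurable_count_space_eq2_countable
proof (intro conjI ballI)
  fix k :: nat
  have "{\<omega> \<in> space M. card (P \<omega> \<inter> B) = k} \<in> point_process_events M \<mu> P"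
    unfolding point_process_events_def using assms by (intro sigma_sets.Basic) auto
  then show "(\<lambda>\<omega>. card (P \<omega> \<inter> B)) -` {k} \<inter> space (sigma (space M) (point_process_events M \<mu> P))
      \<in> sets (sigma (space M) (point_process_events M \<mu> P))"
    unfolding sets_sigma_point_process_events space_sigma_point_process_events
    by (simp add: vimage_def Int_def conj_commute)
qed auto

lemma point_process_events_measurable:
  assumes "poisson_point_process M \<mu> P"
    and "f \<in> sigma (space M) (point_process_events M \<mu> P) \<rightarrow>\<^sub>M N"
  shows "f \<in> M \<rightarrow>\<^sub>M N"
proof -
  have "point_process_events M \<mu> P \<subseteq> sets M"
    unfolding point_process_events_def
  proof (rule sets.sigma_sets_subset, clarify)
    fix B and k :: nat assume "B \<in> sets \<mu>" "bounded B"
    from poisson_point_process_prob_card(1)[OF assms(1) this]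
    have "(\<lambda>\<omega>. card (P \<omega> \<inter> B)) -` {k} \<inter> space M \<in> sets M"
      by (rule measurable_sets) auto
    then show "{\<omega> \<in> space M. card (P \<omega> \<inter> B) = k} \<in> sets M"
      by (simp add: vimage_def Int_def conj_commute)
  qed
  then show ?thesis
    using assms(2) unfolding measurable_def sets_sigma_point_process_events space_sigma_point_process_events
    by auto
qed

section \<open>Arrival counts and smallest marks on the time grid\<close>

definition grid_noise ::
    "(int ^ 'd::finite \<Rightarrow> 'w \<Rightarrow> real set) \<Rightarrow> (int ^ 'd \<Rightarrow> 'w \<Rightarrow> (real \<times> real) set) \<Rightarrow> real \<Rightarrow> real \<Rightarrow>
     (int ^ 'd + int ^ 'd) \<times> nat \<Rightarrow> 'w \<Rightarrow> real" where
  "grid_noise A D t\<^sub>0 \<delta> p \<omega> =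
     (let s = t\<^sub>0 + real (snd p) * \<delta>; s' = t\<^sub>0 + real (Suc (snd p)) * \<delta> in
      case fst p of
        Inl j \<Rightarrow> real (card (A j \<omega> \<inter> {s<..s'}))
      | Inr j \<Rightarrow> min_mark (D j \<omega>) s s')"

locale driven = prob_space M for M :: "'w measure" +
  fixes lam :: real
    and A :: "int ^ 'd::finite \<Rightarrow> 'w \<Rightarrow> real set"
    and D :: "int ^ 'd \<Rightarrow> 'w \<Rightarrow> (real \<times> real) set"
  assumes lam: "0 < lam"
    and driving: "driving_processes M lam A D"
begin

lemma
  shows ppA: "poisson_point_process M (arrival_intensity lam) (A i)"
    and ppD: "poisson_point_process M departure_intensity (D i)"
    and indep_AD: "indep_sets (\<lambda>k. case k of
          Inl i \<Rightarrow> point_process_events M (arrival_intensity lam) (A i)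
        | Inr i \<Rightarrow> point_process_events M departure_intensity (D i)) UNIV"
  using driving unfolding driving_processes_def by auto

lemma finite_A: "\<omega> \<in> space M \<Longrightarrow> bounded B \<Longrightarrow> finite (A i \<omega> \<inter> B)"
  by (rule poisson_point_process_locally_finite[OF ppA])

lemma finite_D: "\<omega> \<in> space M \<Longrightarrow> bounded B \<Longrightarrow> finite (D i \<omega> \<inter> B)"
  by (rule poisson_point_process_locally_finite[OF ppD])

lemma D_subset: "\<omega> \<in> space M \<Longrightarrow> D i \<omega> \<subseteq> UNIV \<times> {0..1}"
proof -
  assume "\<omega> \<in> space M"
  then have "D i \<omega> \<subseteq> space departure_intensity"
    by (rule poisson_point_process_locally_finite[OF ppD])
  then show ?thesis by (simp add: departure_intensity_def space_restrict_space)
qed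

lemma sets_A: "{s<..s'} \<in> sets (arrival_intensity lam)" "bounded {s<..s'::real}"
  by (auto simp: arrival_intensity_def)

lemma sets_D:
  assumes "s \<le> s'" "r \<le> 1"
  shows "{s<..s'} \<times> {0..r} \<in> sets departure_intensity" "bounded ({s<..s'} \<times> {0..r})"
  using measure_departure_intensity(1)[OF assms] by (auto intro: bounded_Times)

lemma card_A_distr:
  assumes "s < s'"
  shows "distr M (count_space UNIV) (\<lambda>\<omega>. card (A i \<omega> \<inter> {s<..s'})) = measure_pmf (poisson_pmf (lam * (s' - s)))"
  using distr_card_poisson[OF ppA sets_A, of s s' i] assms lam
  by (simp add: measure_arrival_intensity)

lemma less_min_mark_D:
  assumes "\<omega> \<in> space M"
  shows "x < min_mark (D i \<omega>) s s' \<longleftrightarrow> x < 2 \<and> card (D i \<omega> \<inter> {s<..s'} \<times> {0..min x 1}) = 0"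
  by (rule less_min_mark_iff) (rule finite_D[OF assms], auto intro: bounded_Times)

lemma min_mark_measurable_events:
  assumes "s \<le> s'"
  shows "(\<lambda>\<omega>. min_mark (D i \<omega>) s s') \<in> borel_measurable (sigma (space M) (point_process_events M departure_intensity (D i)))"
    (is "_ \<in> borel_measurable ?S")
proof (rule borel_measurableI_greater)
  fix x
  have [measurable]: "(\<lambda>\<omega>. card (D i \<omega> \<inter> {s<..s'} \<times> {0..min x 1})) \<in> ?S \<rightarrow>\<^sub>M count_space UNIV"
    by (rule card_measurable_point_process_events) (use sets_D[OF assms, of "min x 1"] in auto)
  have "{\<omega> \<in> space ?S. x < min_mark (D i \<omega>) s s'}
      = {\<omega> \<in> space ?S. x < 2 \<and> card (D i \<omega> \<inter> {s<..s'} \<times> {0..min x 1}) = 0}"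
    unfolding space_sigma_point_process_events by (intro Collect_cong conj_cong refl less_min_mark_D)
  also have "\<dots> \<in> sets ?S" by measurable
  finally show "{\<omega> \<in> space ?S. x < min_mark (D i \<omega>) s s'} \<in> sets ?S" .
qed

lemma prob_less_min_mark:
  assumes "s \<le> s'"
  shows "prob {\<omega> \<in> space M. x < min_mark (D i \<omega>) s s'}
    = (if x < 2 then exp (- (s' - s) * max 0 (min x 1)) else 0)"
proof (cases "x < 2")
  case True
  then have "{\<omega> \<in> space M. x < min_mark (D i \<omega>) s s'}
      = {\<omega> \<in> space M. card (D i \<omega> \<inter> {s<..s'} \<times> {0..min x 1}) = 0}"
    using less_min_mark_D by blast
  also have "prob \<dots> = exp (- (s' - s) * max 0 (min x 1))"
    using poisson_point_process_prob_card(2)[OF ppD sets_D[OF assms], of "min x 1" i 0]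
    by (simp only: measure_departure_intensity(2)[OF assms min.cobounded2]
        minus_mult_left power_0 fact_0 mult_1_right div_by_1 of_nat_1)
  finally show ?thesis using True by simp
next
  case False
  then have "{\<omega> \<in> space M. x < min_mark (D i \<omega>) s s'} = {}"
    using False less_min_mark_D by blast
  then have "prob {\<omega> \<in> space M. x < min_mark (D i \<omega>) s s'} = 0"
    by (simp only: measure_empty)
  then show ?thesis using False by simp
qed

lemma grid_disjoint:
  assumes "0 < \<delta>"
  shows "disjoint_family (\<lambda>m. {t\<^sub>0 + real m * \<delta><..t\<^sub>0 + real (Suc m) * \<delta>})"
  unfolding disjoint_family_on_def
proof (intro ballI impI)
  fix m n :: nat assume "m \<noteq> n"
  then consider "Suc m \<le> n" | "Suc n \<le> m" by linarith
  then show "{t\<^sub>0 + real m * \<delta><..t\<^sub>0 + real (Suc m) * \<delta>} \<inter> {t\<^sub>0 + real n * \<delta><..t\<^sub>0 + real (Suc n) * \<delta>} = {}"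
  proof cases
    case 1
    then have "real (Suc m) * \<delta> \<le> real n * \<delta>" using assms by (intro mult_right_mono) auto
    then show ?thesis by auto
  next
    case 2
    then have "real (Suc n) * \<delta> \<le> real m * \<delta>" using assms by (intro mult_right_mono) auto
    then show ?thesis by auto
  qed
qed

lemma grid_noise_Inl_indep:
  assumes \<delta>: "0 < \<delta>"
  shows "indep_vars (\<lambda>_. borel) (\<lambda>m. grid_noise A D t\<^sub>0 \<delta> (Inl j, m)) UNIV"
proof (rule indep_vars_nat_UNIV)
  fix n :: nat
  let ?B = "\<lambda>m::nat. {t\<^sub>0 + real m * \<delta><..t\<^sub>0 + real (Suc m) * \<delta>}"
  have "indep_vars (\<lambda>_. count_space UNIV) (\<lambda>m \<omega>. card (A j \<omega> \<inter> ?B m)) {..<n}"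
  proof (intro poisson_point_process_indep[OF ppA] sets_A)
    show "disjoint_family_on ?B {..<n}"
      using grid_disjoint[OF \<delta>] by (rule disjoint_family_on_mono[rotated]) simp
  qed
  from indep_vars_compose2[OF this, of "\<lambda>_. real" "\<lambda>_. borel"]
  show "indep_vars (\<lambda>_. borel) (\<lambda>m. grid_noise A D t\<^sub>0 \<delta> (Inl j, m)) {..<n}"
    by (simp add: grid_noise_def[abs_def] Let_def)
qed

text \<open>Rectangles over different steps are disjoint, hence their void events are independent.
  If some level is at least \<open>2\<close>, one event is empty and both sides vanish.\<close>

lemma grid_noise_Inr_indep:
  assumes \<delta>: "0 < \<delta>"
  shows "indep_vars (\<lambda>_. borel) (\<lambda>m. grid_noise A D t\<^sub>0 \<delta> (Inr j, m)) UNIV"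
proof (rule indep_vars_greaterThanI)
  let ?B = "\<lambda>m::nat. {t\<^sub>0 + real m * \<delta><..t\<^sub>0 + real (Suc m) * \<delta>}"
  have U: "grid_noise A D t\<^sub>0 \<delta> (Inr j, m) = (\<lambda>\<omega>. min_mark (D j \<omega>) (t\<^sub>0 + real m * \<delta>) (t\<^sub>0 + real (Suc m) * \<delta>))" for m
    by (simp add: grid_noise_def[abs_def] Let_def)
  have le: "t\<^sub>0 + real m * \<delta> \<le> t\<^sub>0 + real (Suc m) * \<delta>" for m
    using \<delta> by (intro add_left_mono mult_right_mono) auto
  show "random_variable borel (grid_noise A D t\<^sub>0 \<delta> (Inr j, m))" for m
    unfolding U by (rule point_process_events_measurable[OF ppD min_mark_measurable_events]) (rule le)
  fix J :: "nat set" and x :: "nat \<Rightarrow> real" assume J: "finite J" "J \<noteq> {}"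
  show "prob (\<Inter>m\<in>J. {\<omega> \<in> space M. x m < grid_noise A D t\<^sub>0 \<delta> (Inr j, m) \<omega>}) =
      (\<Prod>m\<in>J. prob {\<omega> \<in> space M. x m < grid_noise A D t\<^sub>0 \<delta> (Inr j, m) \<omega>})"
  proof (cases "\<forall>m\<in>J. x m < 2")
    case False
    then obtain m where m: "m \<in> J" "\<not> x m < 2" by blast
    then have e: "{\<omega> \<in> space M. x m < grid_noise A D t\<^sub>0 \<delta> (Inr j, m) \<omega>} = {}"
      unfolding U using less_min_mark_D by blast
    then have "(\<Inter>m\<in>J. {\<omega> \<in> space M. x m < grid_noise A D t\<^sub>0 \<delta> (Inr j, m) \<omega>}) = {}"
      using m(1) by blast
    moreover have "(\<Prod>m\<in>J. prob {\<omega> \<in> space M. x m < grid_noise A D t\<^sub>0 \<delta> (Inr j, m) \<omega>}) = 0"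
      using J(1) m(1) by (intro prod_zero bexI[of _ m]) (simp_all only: e measure_empty)
    ultimately show ?thesis by simp
  next
    case True
    let ?C = "\<lambda>m. ?B m \<times> {0..min (x m) 1}"
    let ?n = "Suc (Max J)"
    have Jn: "J \<subseteq> {..<?n}" using J by (auto simp: less_Suc_eq_le)
    have "disjoint_family ?C"
      using grid_disjoint[OF \<delta>, of t\<^sub>0] unfolding disjoint_family_on_def by blast
    then have "disjoint_family_on ?C {..<?n}"
      by (rule disjoint_family_on_mono[rotated]) simp
    then have "indep_vars (\<lambda>_. count_space UNIV) (\<lambda>m \<omega>. card (D j \<omega> \<inter> ?C m)) {..<?n}"
      by (intro poisson_point_process_indep[OF ppD] sets_D le min.cobounded2)
    then have "prob (\<Inter>m\<in>J. (\<lambda>\<omega>. card (D j \<omega> \<inter> ?C m)) -` {0} \<inter> space M) =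
        (\<Prod>m\<in>J. prob ((\<lambda>\<omega>. card (D j \<omega> \<inter> ?C m)) -` {0} \<inter> space M))"
      by (rule indep_varsD[OF _ J(2,1) Jn]) simp
    moreover have eq: "(\<lambda>\<omega>. card (D j \<omega> \<inter> ?C m)) -` {0} \<inter> space M
        = {\<omega> \<in> space M. x m < grid_noise A D t\<^sub>0 \<delta> (Inr j, m) \<omega>}" if "m \<in> J" for m
    proof -
      have "x m < 2" using True that by blast
      then have "x m < min_mark (D j \<omega>) (t\<^sub>0 + real m * \<delta>) (t\<^sub>0 + real (Suc m) * \<delta>) \<longleftrightarrow> card (D j \<omega> \<inter> ?C m) = 0"
        if "\<omega> \<in> space M" for \<omega>
        using less_min_mark_D[OF that] by blast
      then show ?thesis unfolding U by blast
    qed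
    ultimately have "prob (\<Inter>m\<in>J. (\<lambda>\<omega>. card (D j \<omega> \<inter> ?C m)) -` {0} \<inter> space M) =
        (\<Prod>m\<in>J. prob {\<omega> \<in> space M. x m < grid_noise A D t\<^sub>0 \<delta> (Inr j, m) \<omega>})"
      by (simp only: cong: prod.cong)
    moreover have "(\<Inter>m\<in>J. (\<lambda>\<omega>. card (D j \<omega> \<inter> ?C m)) -` {0} \<inter> space M)
        = (\<Inter>m\<in>J. {\<omega> \<in> space M. x m < grid_noise A D t\<^sub>0 \<delta> (Inr j, m) \<omega>})"
      by (intro INF_cong refl eq)
    ultimately show ?thesis by (simp only:)
  qed
qed

text \<open>The blocks are the sources, a site together with a process type; inside a block the
  index is the number of the step.\<close>

lemma grid_noise_indep:
  assumes \<delta>: "0 < \<delta>"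
  shows "indep_vars (\<lambda>_. borel) (grid_noise A D t\<^sub>0 \<delta>) UNIV"
proof (rule indep_vars_blocks[OF indep_AD])
  fix k :: "int ^ 'd + int ^ 'd"
  let ?F = "case k of Inl i \<Rightarrow> point_process_events M (arrival_intensity lam) (A i)
        | Inr i \<Rightarrow> point_process_events M departure_intensity (D i)"
  show "sigma_algebra (space M) ?F"
    by (auto split: sum.split intro: point_process_events_sigma_algebra)
  show "grid_noise A D t\<^sub>0 \<delta> (k, m) \<in> borel_measurable (sigma (space M) ?F)" for m
  proof (cases k)
    case (Inl i)
    have "(\<lambda>\<omega>. real (card (A i \<omega> \<inter> {t\<^sub>0 + real m * \<delta><..t\<^sub>0 + real (Suc m) * \<delta>})))
        \<in> borel_measurable (sigma (space M) (point_process_events M (arrival_intensity lam) (A i)))"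
      using card_measurable_point_process_events[OF sets_A] by (rule measurable_compose) simp
    then show ?thesis using Inl by (simp add: grid_noise_def[abs_def] Let_def)
  next
    case (Inr i)
    have "t\<^sub>0 + real m * \<delta> \<le> t\<^sub>0 + real (Suc m) * \<delta>"
      using \<delta> by (intro add_left_mono mult_right_mono) auto
    from min_mark_measurable_events[OF this, of i]
    show ?thesis using Inr by (simp add: grid_noise_def[abs_def] Let_def)
  qed
  show "indep_vars (\<lambda>_. borel) (\<lambda>m. grid_noise A D t\<^sub>0 \<delta> (k, m)) UNIV"
    using grid_noise_Inl_indep[OF \<delta>] grid_noise_Inr_indep[OF \<delta>] by (cases k) (simp_all only:)
qed

lemma grid_noise_Inl_distr:
  assumes \<delta>: "0 < \<delta>"
  shows "distr M borel (grid_noise A D t\<^sub>0 \<delta> (Inl j, m)) = distr (measure_pmf (poisson_pmf (lam * \<delta>))) borel real"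
proof -
  let ?s = "t\<^sub>0 + real m * \<delta>" and ?s' = "t\<^sub>0 + real (Suc m) * \<delta>"
  let ?N = "\<lambda>\<omega>. card (A j \<omega> \<inter> {?s<..?s'})"
  have "?s < ?s'" "?s' - ?s = \<delta>" using \<delta> by (auto simp: algebra_simps)
  then have "distr M (count_space UNIV) ?N = measure_pmf (poisson_pmf (lam * \<delta>))"
    using card_A_distr[of ?s ?s' j] by simp
  then have "distr (measure_pmf (poisson_pmf (lam * \<delta>))) borel real = distr (distr M (count_space UNIV) ?N) borel real"
    by simp
  also have "\<dots> = distr M borel (\<lambda>\<omega>. real (?N \<omega>))"
    by (subst distr_distr) (auto simp: comp_def intro: poisson_point_process_prob_card(1)[OF ppA sets_A])
  finally show ?thesis by (simp add: grid_noise_def[abs_def] Let_def)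
qed

lemma prob_less_grid_noise_Inr:
  assumes \<delta>: "0 < \<delta>"
  shows "prob {\<omega> \<in> space M. x < grid_noise A D t\<^sub>0 \<delta> (Inr j, m) \<omega>}
    = (if x < 2 then exp (- \<delta> * max 0 (min x 1)) else 0)"
proof -
  let ?s = "t\<^sub>0 + real m * \<delta>" and ?s' = "t\<^sub>0 + real (Suc m) * \<delta>"
  have "?s \<le> ?s'" "?s' - ?s = \<delta>" using \<delta> by (auto simp: algebra_simps)
  then show ?thesis
    using prob_less_min_mark[of ?s ?s' x j] by (simp add: grid_noise_def[abs_def] Let_def)
qed

text \<open>The laws depend only on the kind of variable, so relabelling sites keeps them; for marks
  the tail function determines the law. This is the source of the homogeneity of the chain.\<close>

lemma grid_noise_shift_distr:
  assumes \<delta>: "0 < \<delta>"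
  shows "distr M borel (grid_noise A D t\<^sub>0 \<delta> (map_sum f f k, m)) = distr M borel (grid_noise A D t\<^sub>0 \<delta> (k, m))"
proof (cases k)
  case (Inl j)
  then show ?thesis by (simp add: grid_noise_Inl_distr[OF \<delta>])
next
  case (Inr j)
  have [measurable]: "random_variable borel (grid_noise A D t\<^sub>0 \<delta> p)" for p
    using grid_noise_indep[OF \<delta>, of t\<^sub>0] unfolding indep_vars_def2 by blast
  have "emeasure (distr M borel (grid_noise A D t\<^sub>0 \<delta> (Inr i, m))) {x<..}
      = ennreal (prob {\<omega> \<in> space M. x < grid_noise A D t\<^sub>0 \<delta> (Inr i, m) \<omega>})" for i x
    by (subst emeasure_distr) (auto simp: emeasure_eq_measure vimage_def Int_def intro!: arg_cong[of _ _ prob])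
  then show ?thesis unfolding Inr
    by (intro measure_eqI_lessThan) (simp_all add: prob_less_grid_noise_Inr[OF \<delta>])
qed

end

section \<open>The dominating chain\<close>

lemma (in prob_space) indep_vars_inj_reindex:
  assumes "indep_vars (\<lambda>_. N) X UNIV" "inj f"
  shows "indep_vars (\<lambda>_. N) (\<lambda>i. X (f i)) UNIV"
  unfolding indep_vars_def2
proof (intro conjI ballI)
  show "random_variable N (X (f i))" for i
    using assms(1) unfolding indep_vars_def2 by blast
  have rv: "random_variable N (X i)" for i
    using assms(1) unfolding indep_vars_def2 by blast
  have ind: "indep_sets (\<lambda>i. {X i -` A \<inter> space M |A. A \<in> sets N}) UNIV"
    using assms(1) unfolding indep_vars_def2 by blast
  show "indep_sets (\<lambda>i. {X (f i) -` A \<inter> space M |A. A \<in> sets N}) UNIV"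
  proof (rule indep_setsI)
    show "{X (f i) -` A \<inter> space M |A. A \<in> sets N} \<subseteq> events" for i
      using rv[of "f i"] by (auto intro: measurable_sets)
  next
    fix A J assume J: "J \<noteq> {}" "finite J"
      and A: "\<forall>j\<in>J. A j \<in> {X (f j) -` A \<inter> space M |A. A \<in> sets N}"
    have inj: "inj_on f J" using assms(2) by (rule inj_on_subset) simp
    have [simp]: "inv f (f j) = j" for j using assms(2) by simp
    have "prob (\<Inter>k\<in>f ` J. A (inv f k)) = (\<Prod>k\<in>f ` J. prob (A (inv f k)))"
      by (rule indep_setsD[OF ind]) (use J A in auto)
    then show "prob (\<Inter>j\<in>J. A j) = (\<Prod>j\<in>J. prob (A j))"
      by (simp add: prod.reindex[OF inj])
  qed
qed

text \<open>The joint law is the product of the marginals, and Tonelli applies. The second sample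
  \<omega>' allows one component to be frozen while the other is averaged.\<close>

lemma (in prob_space) indep_var_nn_integral:
  assumes ind: "indep_var S X T Y" and f: "f \<in> borel_measurable (S \<Otimes>\<^sub>M T)"
  shows "(\<integral>\<^sup>+\<omega>. f (X \<omega>, Y \<omega>) \<partial>M) = (\<integral>\<^sup>+\<omega>. \<integral>\<^sup>+\<omega>'. f (X \<omega>, Y \<omega>') \<partial>M \<partial>M)"
proof -
  note [measurable] = f
  have rv[measurable]: "random_variable S X" "random_variable T Y"
    and eq: "distr M S X \<Otimes>\<^sub>M distr M T Y = distr M (S \<Otimes>\<^sub>M T) (\<lambda>x. (X x, Y x))"
    using ind unfolding indep_var_distribution_eq by auto
  interpret T: prob_space "distr M T Y" by (rule prob_space_distr) (rule rv)
  have "(\<integral>\<^sup>+\<omega>. f (X \<omega>, Y \<omega>) \<partial>M) = (\<integral>\<^sup>+z. f z \<partial>distr M (S \<Otimes>\<^sub>M T) (\<lambda>x. (X x, Y x)))"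
    by (subst nn_integral_distr) auto
  also have "\<dots> = (\<integral>\<^sup>+z. f z \<partial>(distr M S X \<Otimes>\<^sub>M distr M T Y))"
    by (simp only: eq)
  also have "\<dots> = (\<integral>\<^sup>+x. \<integral>\<^sup>+y. f (x, y) \<partial>distr M T Y \<partial>distr M S X)"
    by (subst T.nn_integral_fst[symmetric]) (auto cong: measurable_cong_sets)
  also have "\<dots> = (\<integral>\<^sup>+\<omega>. \<integral>\<^sup>+y. f (X \<omega>, y) \<partial>distr M T Y \<partial>M)"
    by (subst nn_integral_distr) (auto intro!: T.borel_measurable_nn_integral simp: measurable_split_conv cong: measurable_cong_sets)
  also have "\<dots> = (\<integral>\<^sup>+\<omega>. \<integral>\<^sup>+\<omega>'. f (X \<omega>, Y \<omega>') \<partial>M \<partial>M)"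
    by (intro nn_integral_cong, subst nn_integral_distr) (auto dest: measurable_space[OF rv(1)])
  finally show ?thesis .
qed

text \<open>Outside the summable case both sides take the default value \<open>0\<close>. The
  integral form gives access to measurability in a parameter.\<close>

lemma infsum_real_eq_lebesgue_integral:
  fixes f :: "'a \<Rightarrow> real"
  shows "infsum f S = lebesgue_integral (count_space S) f"
proof (cases "f summable_on S")
  case True
  then have "Infinite_Set_Sum.abs_summable_on f S"
    using summable_on_iff_abs_summable_on_real abs_summable_equivalent by blast
  from infsetsum_infsum[OF this] show ?thesis by (simp add: infsetsum_def)
next
  case False
  then have "\<not> Infinite_Set_Sum.abs_summable_on f S"
    using summable_on_iff_abs_summable_on_real abs_summable_equivalent by blast
  then have "\<not> integrable (count_space S) f"
    by (simp add: Infinite_Set_Sum.abs_summable_on_def)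
  with False show ?thesis by (simp add: infsum_not_exists not_integrable_integral_eq)
qed

lemma borel_measurable_infsum:
  fixes f :: "'i::countable \<Rightarrow> 'a \<Rightarrow> real"
  assumes "\<And>i. f i \<in> borel_measurable K"
  shows "(\<lambda>\<omega>. \<Sum>\<^sub>\<infinity>i. f i \<omega>) \<in> borel_measurable K"
proof -
  interpret sigma_finite_measure "count_space (UNIV :: 'i set)"
    by (rule sigma_finite_measure_count_space)
  have "(\<lambda>p. f (snd p) (fst p)) \<in> borel_measurable (K \<Otimes>\<^sub>M count_space UNIV)"
    by (rule measurable_compose_countable[where f="\<lambda>i p. f i (fst p)"])
      (auto intro: measurable_compose[OF measurable_fst assms])
  then have "(\<lambda>\<omega>. LINT i|count_space UNIV. f i \<omega>) \<in> borel_measurable K"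
    by (intro borel_measurable_lebesgue_integral) (simp add: case_prod_beta')
  then show ?thesis by (simp add: infsum_real_eq_lebesgue_integral)
qed

lemma dominating_step_measurable:
  assumes w: "\<And>j. (\<lambda>\<omega>. w \<omega> j) \<in> K \<rightarrow>\<^sub>M count_space UNIV"
    and n: "\<And>j. (\<lambda>\<omega>. n \<omega> j) \<in> K \<rightarrow>\<^sub>M count_space UNIV"
    and u: "(\<lambda>\<omega>. u \<omega> i) \<in> borel_measurable K"
  shows "(\<lambda>\<omega>. dominating_step a (w \<omega>) (n \<omega>) (u \<omega>) i) \<in> K \<rightarrow>\<^sub>M count_space UNIV"
proof -
  note [measurable] = assms
  have [measurable]: "(\<lambda>\<omega>. \<Sum>\<^sub>\<infinity>j. a j * real (w \<omega> (i - j) + n \<omega> (i - j))) \<in> borel_measurable K"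
    by (rule borel_measurable_infsum) measurable
  then have [measurable]: "(\<lambda>\<omega>. step_threshold a (w \<omega>) (n \<omega>) i) \<in> borel_measurable K"
    unfolding step_threshold_def by measurable
  show ?thesis unfolding dominating_step_def by measurable
qed

lemma dominating_step_shift:
  fixes i j :: "int ^ 'd::finite"
  shows "dominating_step a (\<lambda>j. w (j + i)) (\<lambda>j. n (j + i)) (\<lambda>j. u (j + i)) j = dominating_step a w n u (j + i)"
proof -
  have "j - k + i = j + i - k" for k by (simp add: algebra_simps)
  then show ?thesis unfolding dominating_step_def step_threshold_def by (simp only:)
qed

lemma dominating_step_le: "dominating_step a w n u i \<le> w i + n i"
  by (simp add: dominating_step_def)

text \<open>\<open>e (Inl j, m)\<close> and \<open>e (Inr j, m)\<close> are the number of arrivals and the smallest departure mark at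
  site \<open>j\<close> in the \<open>m\<close>-th step. Both are real so that they form a single independent family.\<close>

definition arr :: "(('i + 'i) \<times> nat \<Rightarrow> real) \<Rightarrow> nat \<Rightarrow> 'i \<Rightarrow> nat" where
  "arr e m j = nat \<lfloor>e (Inl j, m)\<rfloor>"

definition mark :: "(('i + 'i) \<times> nat \<Rightarrow> real) \<Rightarrow> nat \<Rightarrow> 'i \<Rightarrow> real" where
  "mark e m j = e (Inr j, m)"

primrec dominating_chain ::
    "(int ^ 'd::finite \<Rightarrow> real) \<Rightarrow> ((int ^ 'd + int ^ 'd) \<times> nat \<Rightarrow> real) \<Rightarrow> nat \<Rightarrow> int ^ 'd \<Rightarrow> nat" where
  "dominating_chain a e 0 = (\<lambda>_. 0)"
| "dominating_chain a e (Suc m) = dominating_step a (dominating_chain a e m) (arr e m) (mark e m)"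

text \<open>The state after \<open>m\<close> steps reads the noise of earlier steps only; this later
  makes it independent of the arrivals and marks of step \<open>m\<close>.\<close>

lemma dominating_chain_cong:
  assumes "\<And>k l. l < m \<Longrightarrow> e (k, l) = e' (k, l)"
  shows "dominating_chain a e m = dominating_chain a e' m"
  using assms
proof (induction m)
  case (Suc m)
  have "arr e m = arr e' m" "mark e m = mark e' m"
    using Suc.prems by (auto simp: arr_def mark_def)
  with Suc show ?case by simp
qed simp

text \<open>The interference sum depends on relative positions only, so the dynamics commutes with
  translations of the grid.\<close>

lemma dominating_chain_shift:
  "dominating_chain a (\<lambda>(k, l). e (map_sum (\<lambda>j. j + i) (\<lambda>j. j + i) k, l)) m j = dominating_chain a e m (j + i)"
proof (induction m arbitrary: j)
  case (Suc m)
  let ?e = "\<lambda>(k, l). e (map_sum (\<lambda>j. j + i) (\<lambda>j. j + i) k, l)"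
  have "dominating_chain a ?e m = (\<lambda>j. dominating_chain a e m (j + i))"
    using Suc by auto
  moreover have "arr ?e m = (\<lambda>j. arr e m (j + i))" "mark ?e m = (\<lambda>j. mark e m (j + i))"
    by (auto simp: arr_def mark_def)
  ultimately show ?case by (simp add: dominating_step_shift)
qed simp

lemma arr_measurable:
  assumes "(\<lambda>\<omega>. X \<omega> (Inl j, m)) \<in> borel_measurable K"
  shows "(\<lambda>\<omega>. arr (X \<omega>) m j) \<in> K \<rightarrow>\<^sub>M count_space UNIV"
  using assms unfolding arr_def by measurable

lemma dominating_chain_measurable:
  assumes "\<And>k l. l < m \<Longrightarrow> (\<lambda>\<omega>. X \<omega> (k, l)) \<in> borel_measurable K"
  shows "(\<lambda>\<omega>. dominating_chain a (X \<omega>) m i) \<in> K \<rightarrow>\<^sub>M count_space UNIV"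
  using assms
proof (induction m arbitrary: i)
  case (Suc m)
  have "(\<lambda>\<omega>. dominating_step a (dominating_chain a (X \<omega>) m) (arr (X \<omega>) m) (mark (X \<omega>) m) i)
      \<in> K \<rightarrow>\<^sub>M count_space UNIV"
    by (rule dominating_step_measurable[OF Suc.IH arr_measurable])
      (auto simp: mark_def intro: Suc.prems)
  then show ?case by simp
qed simp

section \<open>Truncated exponential weights\<close>

definition trunc_weight :: "real \<Rightarrow> nat \<Rightarrow> nat \<Rightarrow> real" where
  "trunc_weight c x\<^sub>0 x = (if x\<^sub>0 \<le> x then exp (c * real x) / real x else 0)"

text \<open>The discrete primitive of the weight: its increment from \<open>x\<close> to
  \<open>y\<close> is the sum of the weight over the range from \<open>x + 1\<close> to
  \<open>y\<close>.\<close>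

definition trunc_weight_sum :: "real \<Rightarrow> nat \<Rightarrow> nat \<Rightarrow> real" where
  "trunc_weight_sum c x\<^sub>0 x = (\<Sum>k\<in>{1..x}. trunc_weight c x\<^sub>0 k)"

context
  fixes c :: real and x\<^sub>0 :: nat
  assumes c: "0 < c" and x0: "1 \<le> c * x\<^sub>0"
begin

lemma x0_pos: "0 < x\<^sub>0"
  using x0 by (cases x\<^sub>0) auto

lemma trunc_weight_nonneg: "0 \<le> trunc_weight c x\<^sub>0 x"
  by (simp add: trunc_weight_def)

lemma trunc_weight_sum_nonneg: "0 \<le> trunc_weight_sum c x\<^sub>0 x"
  by (simp add: trunc_weight_sum_def sum_nonneg trunc_weight_nonneg)

text \<open>\<open>exp (c x) / x\<close> decreases for small \<open>x\<close>. From
  \<open>x >= 1 / c\<close> on, \<open>exp c >= 1 + c >= (x + 1) / x\<close> makes it nondecreasing,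
  and the jump from \<open>0\<close> at the cut-off is upward.\<close>

lemma trunc_weight_mono: "x \<le> y \<Longrightarrow> trunc_weight c x\<^sub>0 x \<le> trunc_weight c x\<^sub>0 y"
proof (induction rule: dec_induct)
  case (step n)
  have "trunc_weight c x\<^sub>0 n \<le> trunc_weight c x\<^sub>0 (Suc n)"
  proof (cases "x\<^sub>0 \<le> n")
    case True
    then have n: "0 < n" using x0_pos by simp
    have "1 \<le> c * real n" using x0 c True by (smt (verit) mult_left_mono of_nat_le_iff)
    then have "real (Suc n) \<le> real n * (1 + c)" by (simp add: algebra_simps)
    also have "\<dots> \<le> real n * exp c" by (intro mult_left_mono) auto
    finally have "exp (c * real n) * real (Suc n) \<le> exp (c * real n) * (real n * exp c)"
      by (intro mult_left_mono) auto
    then have "exp (c * real n) / real n \<le> exp (c * real (Suc n)) / real (Suc n)"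
      using n by (simp add: divide_le_eq le_divide_eq exp_add algebra_simps)
    then show ?thesis using True by (simp add: trunc_weight_def del: of_nat_Suc)
  next
    case False
    then show ?thesis by (simp add: trunc_weight_def)
  qed
  with step show ?case by simp
qed simp

lemma mult_trunc_weight: "real x * trunc_weight c x\<^sub>0 x = (if x\<^sub>0 \<le> x then exp (c * real x) else 0)"
  using x0_pos by (auto simp: trunc_weight_def)

text \<open>The product of \<open>x\<close> and its weight is \<open>exp (c x)\<close> above the
  cut-off and \<open>0\<close> below, so the two differ by at most a constant. The last bound holds
  because the weight vanishes at \<open>0\<close>.\<close>

lemma mult_trunc_weight_bounds: "real x * trunc_weight c x\<^sub>0 x \<le> exp (c * real x)" "exp (c * real x) \<le> real x * trunc_weight c x\<^sub>0 x + exp (c * real x\<^sub>0)"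
  "trunc_weight c x\<^sub>0 x \<le> real x * trunc_weight c x\<^sub>0 x"
proof -
  show "real x * trunc_weight c x\<^sub>0 x \<le> exp (c * real x)" by (simp add: mult_trunc_weight)
  show "exp (c * real x) \<le> real x * trunc_weight c x\<^sub>0 x + exp (c * real x\<^sub>0)"
    using c by (auto simp: mult_trunc_weight not_le)
  show "trunc_weight c x\<^sub>0 x \<le> real x * trunc_weight c x\<^sub>0 x"
  proof (cases "x = 0")
    case False
    then show ?thesis using trunc_weight_nonneg[of x] mult_right_mono[of 1 "real x" "trunc_weight c x\<^sub>0 x"] by simp
  qed (use x0_pos in \<open>simp add: trunc_weight_def\<close>)
qed

lemma trunc_weight_sum_le: "trunc_weight_sum c x\<^sub>0 x \<le> real x * trunc_weight c x\<^sub>0 x"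
proof -
  have "trunc_weight_sum c x\<^sub>0 x \<le> (\<Sum>k\<in>{1..x}. trunc_weight c x\<^sub>0 x)"
    unfolding trunc_weight_sum_def by (intro sum_mono trunc_weight_mono) auto
  then show ?thesis by simp
qed

text \<open>A nondecreasing weight has a convex primitive; this is its tangent inequality at
  \<open>x\<close>. It is written with sums only, so that it carries over to
  \<open>ennreal\<close>.\<close>

lemma trunc_weight_young: "trunc_weight c x\<^sub>0 x * real y + trunc_weight_sum c x\<^sub>0 x \<le> real x * trunc_weight c x\<^sub>0 x + trunc_weight_sum c x\<^sub>0 y"
proof (cases "x \<le> y")
  case True
  have "{1..y} = {1..x} \<union> {x<..y}" using True by auto
  then have "trunc_weight_sum c x\<^sub>0 y = trunc_weight_sum c x\<^sub>0 x + (\<Sum>k\<in>{x<..y}. trunc_weight c x\<^sub>0 k)"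
    unfolding trunc_weight_sum_def by (metis (no_types, lifting) finite_atLeastAtMost finite_greaterThanAtMost ivl_disj_int_two(8) sum.union_disjoint)
  moreover have "(\<Sum>k\<in>{x<..y}. trunc_weight c x\<^sub>0 x) \<le> (\<Sum>k\<in>{x<..y}. trunc_weight c x\<^sub>0 k)"
    by (intro sum_mono trunc_weight_mono) auto
  ultimately show ?thesis using True by (simp add: algebra_simps of_nat_diff)
next
  case False
  have "{1..x} = {1..y} \<union> {y<..x}" using False by auto
  then have "trunc_weight_sum c x\<^sub>0 x = trunc_weight_sum c x\<^sub>0 y + (\<Sum>k\<in>{y<..x}. trunc_weight c x\<^sub>0 k)"
    unfolding trunc_weight_sum_def by (metis (no_types, lifting) finite_atLeastAtMost finite_greaterThanAtMost ivl_disj_int_two(8) sum.union_disjoint)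
  moreover have "(\<Sum>k\<in>{y<..x}. trunc_weight c x\<^sub>0 k) \<le> (\<Sum>k\<in>{y<..x}. trunc_weight c x\<^sub>0 x)"
    by (intro sum_mono trunc_weight_mono) auto
  ultimately show ?thesis using False by (simp add: algebra_simps of_nat_diff)
qed

end

section \<open>Exponential moments of the dominating chain\<close>

text \<open>Here \<open>s\<close> stands for the sum of \<open>a\<close> and \<open>S\<close> for
  the interference sum at the site. A departure multiplies the exponential by
  \<open>exp (- c)\<close>. Its probability is bounded below by a multiple of \<open>w / S\<close>,
  and \<open>w / S\<close> by an expression affine in \<open>S\<close>, whose expectation can be
  controlled.\<close>

lemma drift_inequality:
  fixes c \<delta> s w n S :: real
  assumes pos: "0 < c" "0 < \<delta>" "0 < s" "0 < w" "0 \<le> n" "w \<le> S"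
  defines "b \<equiv> (1 - exp (- c)) / (1 + \<delta>)"
  shows "exp (c * (w + n - 1)) * (1 - exp (- \<delta> * (w / S))) + exp (c * (w + n)) * exp (- \<delta> * (w / S))
      + 2 * b * \<delta> / s * exp (c * w)
    \<le> exp (c * (w + n)) + b * \<delta> / s\<^sup>2 * (exp (c * w) / w) * S"
proof -
  have S: "0 < S" using pos by linarith
  define \<rho> where "\<rho> = w / S"
  have \<rho>: "0 < \<rho>" "\<rho> \<le> 1" using pos S by (auto simp: \<rho>_def)
  define p where "p = 1 - exp (- \<delta> * \<rho>)"
  have c1: "0 < 1 - exp (- c)" using pos by simp
  have b: "0 < b" unfolding b_def using c1 pos by simp
  \<comment> \<open>Together with \<rho> \<le> 1 this bounds the departure probability below by
    \<open>\<delta> * \<rho> / (1 + \<delta>)\<close>, which explains the denominator of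
    \<open>b\<close>.\<close>
  have "exp (- \<delta> * \<rho>) \<le> 1 / (1 + \<delta> * \<rho>)"
  proof -
    have "1 + \<delta> * \<rho> \<le> exp (\<delta> * \<rho>)" by (rule exp_ge_add_one_self)
    then show ?thesis using pos \<rho> by (simp add: exp_minus field_simps add_pos_pos)
  qed
  moreover have "\<delta> * \<rho> / (1 + \<delta> * \<rho>) = 1 - 1 / (1 + \<delta> * \<rho>)"
    using mult_pos_pos[OF pos(2) \<rho>(1)] by (simp add: field_simps)
  ultimately have "\<delta> * \<rho> / (1 + \<delta> * \<rho>) \<le> p"
    unfolding p_def by linarith
  moreover have "\<delta> * \<rho> / (1 + \<delta>) \<le> \<delta> * \<rho> / (1 + \<delta> * \<rho>)"
    using pos \<rho> by (intro divide_left_mono mult_pos_pos add_pos_pos) (auto simp: mult_left_le)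
  ultimately have p: "\<delta> * \<rho> / (1 + \<delta>) \<le> p" by linarith
  have "exp (c * w) * (b * \<delta> * \<rho>) = exp (c * w) * ((1 - exp (- c)) * (\<delta> * \<rho> / (1 + \<delta>)))"
    by (simp add: b_def)
  also have "\<dots> \<le> exp (c * (w + n)) * ((1 - exp (- c)) * p)"
    using pos c1 p \<rho> by (intro mult_mono) auto
  finally have 1: "exp (c * w) * (b * \<delta> * \<rho>) \<le> exp (c * (w + n)) * ((1 - exp (- c)) * p)" .
  \<comment> \<open>Expanding the square gives \<open>\<rho> >= 2 / s - (S / w) / s\<^sup>2\<close>,
    with equality for \<open>S = s * w\<close>, the case of equal queues without arrivals.\<close>
  have "0 \<le> (1 - S / w / s)\<^sup>2 * (w / S)" using pos S by simp
  also have "(1 - S / w / s)\<^sup>2 * (w / S) = \<rho> + S / w / s\<^sup>2 - 2 / s"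
    using pos S unfolding \<rho>_def by (simp add: field_simps power2_eq_square)
  finally have "exp (c * w) * b * \<delta> * (2 / s) \<le> exp (c * w) * b * \<delta> * (\<rho> + S / w / s\<^sup>2)"
    using b pos by (intro mult_left_mono) auto
  then have 2: "2 * b * \<delta> / s * exp (c * w) \<le> exp (c * w) * (b * \<delta> * \<rho>) + b * \<delta> / s\<^sup>2 * (exp (c * w) / w) * S"
    by (simp add: algebra_simps)
  have "exp (c * (w + n - 1)) = exp (c * (w + n)) * exp (- c)"
    by (simp add: algebra_simps flip: exp_add)
  then have "exp (c * (w + n - 1)) * (1 - exp (- \<delta> * (w / S))) + exp (c * (w + n)) * exp (- \<delta> * (w / S))
      = exp (c * (w + n)) - exp (c * (w + n)) * ((1 - exp (- c)) * p)"
    unfolding p_def \<rho>_def by (simp add: algebra_simps)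
  with 1 2 show ?thesis by linarith
qed

lemma nn_integral_poisson_exp:
  assumes "0 < \<mu>"
  shows "(\<integral>\<^sup>+k. ennreal (exp (c * real k)) \<partial>measure_pmf (poisson_pmf \<mu>)) = ennreal (exp (\<mu> * (exp c - 1)))"
proof -
  have "(\<integral>\<^sup>+k. ennreal (exp (c * real k)) \<partial>measure_pmf (poisson_pmf \<mu>))
      = (\<Sum>k. ennreal (exp (- \<mu>) * ((\<mu> * exp c) ^ k /\<^sub>R fact k)))"
    unfolding nn_integral_measure_pmf nn_integral_count_space_nat using assms
    by (intro suminf_cong)
      (simp add: exp_of_nat2_mult[symmetric] power_mult_distrib divide_inverse mult_ac flip: ennreal_mult')
  also have "\<dots> = ennreal (exp (- \<mu>) * exp (\<mu> * exp c))"
    using assms by (intro suminf_ennreal_eq sums_mult exp_converges) simp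
  also have "exp (- \<mu>) * exp (\<mu> * exp c) = exp (\<mu> * (exp c - 1))"
    by (simp add: algebra_simps flip: exp_add)
  finally show ?thesis .
qed

text \<open>The moment estimate sees the driving processes only through these laws: \<mu> is the
  mean number of arrivals in a step, \<delta> the length of a step. An empty set of marks shows up
  as an atom of mass \<open>exp (- \<delta>)\<close> at \<open>2\<close>.\<close>

locale dominating_noise = prob_space M for M :: "'w measure" +
  fixes a :: "int ^ 'd::finite \<Rightarrow> real"
    and \<xi> :: "(int ^ 'd + int ^ 'd) \<times> nat \<Rightarrow> 'w \<Rightarrow> real"
    and \<mu> \<delta> :: real
  assumes interference: "interference_sequence a"
    and \<mu>: "0 < \<mu>" and \<delta>: "0 < \<delta>"
    and indep: "indep_vars (\<lambda>_. borel) \<xi> UNIV"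
    and arr_distr: "\<And>j m. distr M borel (\<xi> (Inl j, m)) = distr (measure_pmf (poisson_pmf \<mu>)) borel real"
    and mark_prob: "\<And>j m x. prob {\<omega> \<in> space M. x < \<xi> (Inr j, m) \<omega>}
      = (if x < 2 then exp (- \<delta> * max 0 (min x 1)) else 0)"
    and shift_distr: "\<And>f k m. distr M borel (\<xi> (map_sum f f k, m)) = distr M borel (\<xi> (k, m))"
begin

abbreviation "W m i \<omega> \<equiv> dominating_chain a (\<lambda>p. \<xi> p \<omega>) m i"
abbreviation "N m i \<omega> \<equiv> arr (\<lambda>p. \<xi> p \<omega>) m i"
abbreviation "sa \<equiv> infsum a UNIV"

lemma \<xi>_measurable [measurable]: "\<xi> p \<in> borel_measurable M"
  using indep unfolding indep_vars_def2 by blast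

lemma W_measurable [measurable]: "W m i \<in> M \<rightarrow>\<^sub>M count_space UNIV"
  by (rule dominating_chain_measurable) simp

lemma N_measurable [measurable]: "N m i \<in> M \<rightarrow>\<^sub>M count_space UNIV"
  by (rule arr_measurable) simp

lemma a_nonneg: "0 \<le> a j" and a_0: "a 0 = 1" and a_summable: "a summable_on UNIV"
  using interference unfolding interference_sequence_def by auto

lemma sa_pos: "0 < sa"
  using finite_sum_le_infsum[OF a_summable, of "{0}"] a_nonneg a_0 by auto

lemma nn_integral_a: "(\<integral>\<^sup>+j. ennreal (a j) \<partial>count_space UNIV) = ennreal sa"
proof -
  have "integrable (count_space UNIV) a"
    using a_summable summable_on_iff_abs_summable_on_real abs_summable_equivalent
    unfolding Infinite_Set_Sum.abs_summable_on_def by blast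
  then show ?thesis
    using a_nonneg by (simp add: nn_integral_eq_integral infsum_real_eq_lebesgue_integral)
qed

text \<open>The translated noise is again independent with the same marginals, so its joint law on
  the product space is unchanged; the chain at \<open>i\<close> is the chain at \<open>0\<close> run
  on the translated noise.\<close>

lemma nn_integral_W_shift: "(\<integral>\<^sup>+\<omega>. \<phi> (W m i \<omega>) \<partial>M) = (\<integral>\<^sup>+\<omega>. \<phi> (W m 0 \<omega>) \<partial>M)"
proof -
  let ?f = "\<lambda>j. j + i"
  let ?sh = "\<lambda>(k, l). (map_sum ?f ?f k, l)"
  let ?P = "\<Pi>\<^sub>M p\<in>UNIV. (borel :: real measure)"
  have inj: "inj ?sh"
    by (auto simp: inj_on_def sum.inj_map intro!: injI dest: injD[OF sum.inj_map, rotated 2])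
  have ind: "indep_vars (\<lambda>_. borel) (\<lambda>p. \<xi> (?sh p)) UNIV"
    using indep inj by (rule indep_vars_inj_reindex)
  have "distr M ?P (\<lambda>\<omega>. \<lambda>p\<in>UNIV. \<xi> (?sh p) \<omega>) = (\<Pi>\<^sub>M p\<in>UNIV. distr M borel (\<xi> (?sh p)))"
    using ind by (subst (asm) indep_vars_iff_distr_eq_PiM) auto
  also have "\<dots> = (\<Pi>\<^sub>M p\<in>UNIV. distr M borel (\<xi> p))"
    by (intro PiM_cong refl) (auto simp: shift_distr split: prod.split)
  also have "\<dots> = distr M ?P (\<lambda>\<omega>. \<lambda>p\<in>UNIV. \<xi> p \<omega>)"
    using indep by (subst (asm) indep_vars_iff_distr_eq_PiM) auto
  finally have eq: "distr M ?P (\<lambda>\<omega> p. \<xi> (?sh p) \<omega>) = distr M ?P (\<lambda>\<omega> p. \<xi> p \<omega>)"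
    unfolding restrict_UNIV .
  have [measurable]: "(\<lambda>e. dominating_chain a e m 0) \<in> ?P \<rightarrow>\<^sub>M count_space UNIV"
    by (rule dominating_chain_measurable) measurable
  have "(\<lambda>\<omega>. \<lambda>p\<in>UNIV. \<xi> p \<omega>) \<in> M \<rightarrow>\<^sub>M ?P" "(\<lambda>\<omega>. \<lambda>p\<in>UNIV. \<xi> (?sh p) \<omega>) \<in> M \<rightarrow>\<^sub>M ?P"
    by (rule measurable_restrict, measurable)+
  then have [measurable]: "(\<lambda>\<omega> p. \<xi> p \<omega>) \<in> M \<rightarrow>\<^sub>M ?P" "(\<lambda>\<omega> p. \<xi> (?sh p) \<omega>) \<in> M \<rightarrow>\<^sub>M ?P"
    unfolding restrict_UNIV .
  have "(\<integral>\<^sup>+\<omega>. \<phi> (W m i \<omega>) \<partial>M) = (\<integral>\<^sup>+\<omega>. \<phi> (dominating_chain a (\<lambda>p. \<xi> (?sh p) \<omega>) m 0) \<partial>M)"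
    using dominating_chain_shift[of a "\<lambda>p. \<xi> p _" i m 0] by (simp add: case_prod_beta')
  also have "\<dots> = (\<integral>\<^sup>+e. \<phi> (dominating_chain a e m 0) \<partial>distr M ?P (\<lambda>\<omega> p. \<xi> (?sh p) \<omega>))"
    by (subst nn_integral_distr) auto
  also have "\<dots> = (\<integral>\<^sup>+\<omega>. \<phi> (W m 0 \<omega>) \<partial>M)"
    unfolding eq by (subst nn_integral_distr) auto
  finally show ?thesis .
qed

lemma nn_integral_N_exp: "(\<integral>\<^sup>+\<omega>. ennreal (exp (c * real (N m j \<omega>))) \<partial>M) = ennreal (exp (\<mu> * (exp c - 1)))"
proof -
  let ?g = "\<lambda>x::real. ennreal (exp (c * real (nat \<lfloor>x\<rfloor>)))"
  have "(\<integral>\<^sup>+\<omega>. ennreal (exp (c * real (N m j \<omega>))) \<partial>M) = (\<integral>\<^sup>+x. ?g x \<partial>distr M borel (\<xi> (Inl j, m)))"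
    by (subst nn_integral_distr) (auto simp: arr_def)
  also have "\<dots> = (\<integral>\<^sup>+k. ennreal (exp (c * real k)) \<partial>measure_pmf (poisson_pmf \<mu>))"
    unfolding arr_distr by (subst nn_integral_distr) auto
  finally show ?thesis using nn_integral_poisson_exp[OF \<mu>] by simp
qed

text \<open>From \<open>1 + c N <= exp (c N)\<close>. Bounding the mean by the exponential moment
  leaves that moment as the only arrival quantity in the recursion.\<close>

lemma nn_integral_N_le:
  assumes "0 < c"
  shows "(\<integral>\<^sup>+\<omega>. ennreal (real (N m j \<omega>)) \<partial>M) \<le> ennreal ((exp (\<mu> * (exp c - 1)) - 1) / c)"
proof -
  have "1 + ennreal c * (\<integral>\<^sup>+\<omega>. ennreal (real (N m j \<omega>)) \<partial>M) = (\<integral>\<^sup>+\<omega>. 1 + ennreal c * ennreal (real (N m j \<omega>)) \<partial>M)"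
    by (subst nn_integral_add) (auto simp: nn_integral_cmult emeasure_space_1)
  also have "\<dots> \<le> (\<integral>\<^sup>+\<omega>. ennreal (exp (c * real (N m j \<omega>))) \<partial>M)"
    using assms exp_ge_add_one_self
    by (intro nn_integral_mono) (auto simp flip: ennreal_mult' ennreal_1 ennreal_plus intro!: ennreal_leI)
  finally have le: "1 + ennreal c * (\<integral>\<^sup>+\<omega>. ennreal (real (N m j \<omega>)) \<partial>M) \<le> ennreal (exp (\<mu> * (exp c - 1)))"
    by (simp only: nn_integral_N_exp)
  then obtain r where r: "(\<integral>\<^sup>+\<omega>. ennreal (real (N m j \<omega>)) \<partial>M) = ennreal r" "0 \<le> r"
    using assms by (cases "\<integral>\<^sup>+\<omega>. ennreal (real (N m j \<omega>)) \<partial>M") (auto simp: ennreal_mult_top top_unique)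
  have "ennreal (1 + c * r) \<le> ennreal (exp (\<mu> * (exp c - 1)))"
    using le r assms by (simp add: ennreal_mult' ennreal_plus flip: ennreal_1)
  then have "1 + c * r \<le> exp (\<mu> * (exp c - 1))" by (simp add: ennreal_le_iff)
  then show ?thesis unfolding r(1) using assms by (intro ennreal_leI) (simp add: field_simps)
qed

text \<open>Only the mark is random; \<open>w\<close> and \<open>n\<close> are frozen. Below the
  cut-off the weight is \<open>0\<close> and monotonicity is enough; if the interference sum
  diverges, the right side is infinite; otherwise \<open>drift_inequality\<close> applies with that
  sum as \<open>S\<close>.\<close>

lemma nn_integral_dominating_step:
  fixes w n :: "int ^ 'd \<Rightarrow> nat"
  assumes c: "0 < c" and x0: "1 \<le> c * real x\<^sub>0"
  defines "b \<equiv> (1 - exp (- c)) / (1 + \<delta>)"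
  shows "(\<integral>\<^sup>+\<omega>. ennreal (exp (c * real (dominating_step a w n (\<lambda>_. \<xi> (Inr i, m) \<omega>) i))) \<partial>M)
      + ennreal (2 * b * \<delta> / sa * (real (w i) * trunc_weight c x\<^sub>0 (w i)))
    \<le> ennreal (exp (c * (real (w i) + real (n i))))
      + ennreal (b * \<delta> / sa\<^sup>2 * trunc_weight c x\<^sub>0 (w i)) *
        (\<integral>\<^sup>+j. ennreal (a j * (real (w (i - j)) + real (n (i - j)))) \<partial>count_space UNIV)"
    (is "?I + _ \<le> ?E + ?u * ?T")
proof -
  have b: "0 < b" unfolding b_def using c \<delta> by simp
  have bound: "?I \<le> ?E"
  proof -
    have "?I \<le> (\<integral>\<^sup>+\<omega>. ?E \<partial>M)"
    proof (intro nn_integral_mono ennreal_leI iffD2[OF exp_le_cancel_iff] mult_left_mono)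
      fix \<omega>
      show "real (dominating_step a w n (\<lambda>_. \<xi> (Inr i, m) \<omega>) i) \<le> real (w i) + real (n i)"
        using dominating_step_le[of a w n _ i] by (simp flip: of_nat_add)
    qed (use c in auto)
    then show ?thesis by (simp add: emeasure_space_1)
  qed
  consider "\<not> x\<^sub>0 \<le> w i" | "x\<^sub>0 \<le> w i" "?T = \<infinity>" | "x\<^sub>0 \<le> w i" "?T \<noteq> \<infinity>" by blast
  then show ?thesis
  proof cases
    case 1
    then show ?thesis using bound by (simp add: trunc_weight_def)
  next
    case 2
    then have "0 < w i" using x0_pos[OF c x0] by simp
    then have "0 < b * \<delta> / sa\<^sup>2 * trunc_weight c x\<^sub>0 (w i)"
      using 2 b \<delta> sa_pos by (simp add: trunc_weight_def)
    then have "?u \<noteq> 0" by (simp only: ennreal_eq_0_iff not_le)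
    then have "?u * ?T = \<infinity>" by (simp only: 2(2) infinity_ennreal_def ennreal_mult_top if_False)
    then show ?thesis by simp
  next
    case 3
    have wpos: "0 < w i" using 3 x0_pos[OF c x0] by simp
    define f where "f j = a j * (real (w (i - j)) + real (n (i - j)))" for j
    define S where "S = infsum f UNIV"
    have f0: "0 \<le> f j" for j using a_nonneg by (simp add: f_def)
    have "integrable (count_space UNIV) f"
      using 3 f0 by (intro integrableI_nonneg) (auto simp: f_def less_top)
    then have T: "?T = ennreal S"
      using f0 unfolding S_def infsum_real_eq_lebesgue_integral
      by (subst nn_integral_eq_integral[symmetric]) (auto simp: f_def)
    have "ennreal (f 0) \<le> ennreal S"
      using nn_integral_ge_point[of 0 UNIV "\<lambda>j. ennreal (f j)"] T by (simp add: f_def)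
    moreover have "0 \<le> S" unfolding S_def using f0 by (intro infsum_nonneg) auto
    ultimately have "f 0 \<le> S" by (simp add: ennreal_le_iff)
    then have S: "real (w i) \<le> S" "0 < S" using wpos by (auto simp: f_def a_0)
    define \<rho> where "\<rho> = real (w i) / S"
    have \<rho>: "0 < \<rho>" "\<rho> \<le> 1" using wpos S by (auto simp: \<rho>_def)
    have thr: "step_threshold a w n i = \<rho>"
      unfolding step_threshold_def \<rho>_def S_def f_def by simp
    \<comment> \<open>The event that the chain has no departure at \<open>i\<close> in this
      step.\<close>
    let ?G = "{\<omega> \<in> space M. \<rho> < \<xi> (Inr i, m) \<omega>}"
    let ?\<alpha> = "exp (c * (real (w i) + real (n i) - 1))" and ?\<beta> = "exp (c * (real (w i) + real (n i)))"
    have G: "prob ?G = exp (- \<delta> * \<rho>)"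
      using \<rho> by (simp add: mark_prob)
    have "prob (space M - ?G) = 1 - prob ?G" by (rule prob_compl) measurable
    with G have L: "prob (space M - ?G) = 1 - exp (- \<delta> * \<rho>)" by simp
    have "?I = (\<integral>\<^sup>+\<omega>. ennreal ?\<alpha> * indicator (space M - ?G) \<omega> + ennreal ?\<beta> * indicator ?G \<omega> \<partial>M)"
      using \<rho> wpos by (intro nn_integral_cong)
        (auto simp: dominating_step_def thr not_less of_nat_diff split: split_indicator)
    also have "\<dots> = ennreal ?\<alpha> * emeasure M (space M - ?G) + ennreal ?\<beta> * emeasure M ?G"
      by (subst nn_integral_add) (auto simp: nn_integral_cmult)
    also have "\<dots> = ennreal (?\<alpha> * (1 - exp (- \<delta> * \<rho>)) + ?\<beta> * exp (- \<delta> * \<rho>))"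
      unfolding emeasure_eq_measure L G using \<rho> \<delta> by (simp add: ennreal_mult' ennreal_plus)
    finally have I: "?I = ennreal (?\<alpha> * (1 - exp (- \<delta> * \<rho>)) + ?\<beta> * exp (- \<delta> * \<rho>))" .
    have u: "trunc_weight c x\<^sub>0 (w i) = exp (c * real (w i)) / real (w i)"
      using 3 by (simp add: trunc_weight_def)
    have "?\<alpha> * (1 - exp (- \<delta> * \<rho>)) + ?\<beta> * exp (- \<delta> * \<rho>) + 2 * b * \<delta> / sa * exp (c * real (w i))
        \<le> ?\<beta> + b * \<delta> / sa\<^sup>2 * (exp (c * real (w i)) / real (w i)) * S"
      unfolding \<rho>_def b_def by (rule drift_inequality) (use c \<delta> sa_pos wpos S in auto)
    then show ?thesis
      unfolding I T u using wpos b \<delta> sa_pos S \<rho>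
      by (simp add: ennreal_leI flip: ennreal_plus ennreal_mult')
  qed
qed


lemma nn_integral_indep_split:
  assumes "P \<inter> Q = {}"
    and "F \<in> borel_measurable ((\<Pi>\<^sub>M p\<in>P. borel) \<Otimes>\<^sub>M (\<Pi>\<^sub>M p\<in>Q. borel))"
  shows "(\<integral>\<^sup>+\<omega>. F (\<lambda>p\<in>P. \<xi> p \<omega>, \<lambda>p\<in>Q. \<xi> p \<omega>) \<partial>M)
    = (\<integral>\<^sup>+\<omega>. \<integral>\<^sup>+\<omega>'. F (\<lambda>p\<in>P. \<xi> p \<omega>, \<lambda>p\<in>Q. \<xi> p \<omega>') \<partial>M \<partial>M)"
  by (rule indep_var_nn_integral[OF indep_var_restrict[OF indep assms(1)] assms(2)]) auto

lemma W_restrict: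
  assumes "UNIV \<times> {..<m} \<subseteq> P"
  shows "dominating_chain a (\<lambda>p\<in>P. \<xi> p \<omega>) m = dominating_chain a (\<lambda>p. \<xi> p \<omega>) m"
  by (rule dominating_chain_cong) (use assms in auto)

text \<open>\<open>W m\<close> reads the noise of steps before \<open>m\<close> and
  \<open>N m\<close> that of step \<open>m\<close>, so the two are independent even at the same
  site.\<close>

lemma nn_integral_W_N:
  fixes \<phi> \<psi> :: "nat \<Rightarrow> ennreal"
  shows "(\<integral>\<^sup>+\<omega>. \<phi> (W m i \<omega>) * \<psi> (N m j \<omega>) \<partial>M) = (\<integral>\<^sup>+\<omega>. \<phi> (W m i \<omega>) \<partial>M) * (\<integral>\<^sup>+\<omega>. \<psi> (N m j \<omega>) \<partial>M)"
proof -
  let ?P = "UNIV \<times> {..<m}" and ?Q = "{(Inl j, m)}"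
  let ?F = "\<lambda>z. \<phi> (dominating_chain a (fst z) m i) * \<psi> (arr (snd z) m j)"
  let ?S = "\<Pi>\<^sub>M p\<in>?P. (borel :: real measure)" and ?T = "\<Pi>\<^sub>M p\<in>?Q. (borel :: real measure)"
  have [measurable]: "(\<lambda>z. dominating_chain a (fst z) m i) \<in> ?S \<Otimes>\<^sub>M ?T \<rightarrow>\<^sub>M count_space UNIV"
    by (rule dominating_chain_measurable, rule measurable_compose[OF measurable_fst], rule measurable_component_singleton) auto
  have [measurable]: "(\<lambda>z. arr (snd z) m j) \<in> ?S \<Otimes>\<^sub>M ?T \<rightarrow>\<^sub>M count_space UNIV"
    by (rule arr_measurable, rule measurable_compose[OF measurable_snd], rule measurable_component_singleton) auto
  have [measurable]: "\<phi> \<in> borel_measurable (count_space UNIV)" "\<psi> \<in> borel_measurable (count_space UNIV)"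
    by simp_all
  have [measurable]: "(\<lambda>\<omega>. \<phi> (W m i \<omega>)) \<in> borel_measurable M" "(\<lambda>\<omega>. \<psi> (N m j \<omega>)) \<in> borel_measurable M"
    by (rule measurable_compose[OF W_measurable] measurable_compose[OF N_measurable], simp)+
  have F: "?F \<in> borel_measurable (?S \<Otimes>\<^sub>M ?T)" by measurable
  have "?P \<inter> ?Q = {}" by auto
  have arr_eq: "arr (\<lambda>p\<in>?Q. \<xi> p \<omega>) m j = N m j \<omega>" for \<omega>
    by (simp add: arr_def)
  have "(\<integral>\<^sup>+\<omega>. \<phi> (W m i \<omega>) * \<psi> (N m j \<omega>) \<partial>M) = (\<integral>\<^sup>+\<omega>. ?F (\<lambda>p\<in>?P. \<xi> p \<omega>, \<lambda>p\<in>?Q. \<xi> p \<omega>) \<partial>M)"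
    by (simp only: fst_conv snd_conv W_restrict[OF subset_refl] arr_eq)
  also have "\<dots> = (\<integral>\<^sup>+\<omega>. \<integral>\<^sup>+\<omega>'. ?F (\<lambda>p\<in>?P. \<xi> p \<omega>, \<lambda>p\<in>?Q. \<xi> p \<omega>') \<partial>M \<partial>M)"
    by (rule nn_integral_indep_split) fact+
  also have "\<dots> = (\<integral>\<^sup>+\<omega>. \<integral>\<^sup>+\<omega>'. \<phi> (W m i \<omega>) * \<psi> (N m j \<omega>') \<partial>M \<partial>M)"
    by (simp only: fst_conv snd_conv W_restrict[OF subset_refl] arr_eq)
  also have "\<dots> = (\<integral>\<^sup>+\<omega>. \<phi> (W m i \<omega>) \<partial>M) * (\<integral>\<^sup>+\<omega>. \<psi> (N m j \<omega>) \<partial>M)"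
    by (simp only: nn_integral_cmult[OF \<open>(\<lambda>\<omega>. \<psi> (N m j \<omega>)) \<in> borel_measurable M\<close>] nn_integral_multc[OF \<open>(\<lambda>\<omega>. \<phi> (W m i \<omega>)) \<in> borel_measurable M\<close>])
  finally show ?thesis .
qed

text \<open>Of the marks of step \<open>m\<close> only the one at site \<open>i\<close> influences
  queue \<open>i\<close> at the end of the step. It is independent of the past and of all arrivals
  of the step, and can be averaged first.\<close>

lemma nn_integral_W_Suc:
  fixes \<phi> :: "nat \<Rightarrow> ennreal"
  shows "(\<integral>\<^sup>+\<omega>. \<phi> (W (Suc m) i \<omega>) \<partial>M)
    = (\<integral>\<^sup>+\<omega>. \<integral>\<^sup>+\<omega>'. \<phi> (dominating_step a (\<lambda>j. W m j \<omega>) (\<lambda>j. N m j \<omega>) (\<lambda>_. \<xi> (Inr i, m) \<omega>') i) \<partial>M \<partial>M)"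
proof -
  let ?P = "UNIV \<times> {..<m} \<union> range Inl \<times> {m}" and ?Q = "{(Inr i, m)}"
  let ?F = "\<lambda>z. \<phi> (dominating_step a (dominating_chain a (fst z) m) (arr (fst z) m) (\<lambda>_. snd z (Inr i, m)) i)"
  let ?S = "\<Pi>\<^sub>M p\<in>?P. (borel :: real measure)" and ?T = "\<Pi>\<^sub>M p\<in>?Q. (borel :: real measure)"
  have "(\<lambda>z. dominating_step a (dominating_chain a (fst z) m) (arr (fst z) m) (\<lambda>_. snd z (Inr i, m)) i)
      \<in> ?S \<Otimes>\<^sub>M ?T \<rightarrow>\<^sub>M count_space UNIV"
  proof (rule dominating_step_measurable)
    show "(\<lambda>z. dominating_chain a (fst z) m j) \<in> ?S \<Otimes>\<^sub>M ?T \<rightarrow>\<^sub>M count_space UNIV" for j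
      by (rule dominating_chain_measurable, rule measurable_compose[OF measurable_fst], rule measurable_component_singleton) auto
    show "(\<lambda>z. arr (fst z) m j) \<in> ?S \<Otimes>\<^sub>M ?T \<rightarrow>\<^sub>M count_space UNIV" for j
      by (rule arr_measurable, rule measurable_compose[OF measurable_fst], rule measurable_component_singleton) auto
    show "(\<lambda>z. snd z (Inr i, m)) \<in> borel_measurable (?S \<Otimes>\<^sub>M ?T)"
      by (rule measurable_compose[OF measurable_snd], rule measurable_component_singleton) auto
  qed
  then have F: "?F \<in> borel_measurable (?S \<Otimes>\<^sub>M ?T)" by (rule measurable_compose) simp
  have "?P \<inter> ?Q = {}" by auto
  have sub: "UNIV \<times> {..<m} \<subseteq> ?P" by auto
  have arr_eq: "arr (\<lambda>p\<in>?P. \<xi> p \<omega>) m = (\<lambda>j. N m j \<omega>)" for \<omega>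
    by (auto simp: arr_def fun_eq_iff)
  have F_eq: "?F (\<lambda>p\<in>?P. \<xi> p \<omega>, \<lambda>p\<in>?Q. \<xi> p \<omega>')
      = \<phi> (dominating_step a (\<lambda>j. W m j \<omega>) (\<lambda>j. N m j \<omega>) (\<lambda>_. \<xi> (Inr i, m) \<omega>') i)" for \<omega> \<omega>'
    unfolding fst_conv snd_conv W_restrict[OF sub] arr_eq by (simp only: restrict_apply singletonI if_True)
  have "W (Suc m) i \<omega> = dominating_step a (\<lambda>j. W m j \<omega>) (\<lambda>j. N m j \<omega>) (\<lambda>_. \<xi> (Inr i, m) \<omega>) i" for \<omega>
    unfolding dominating_chain.simps(2) dominating_step_def mark_def by (rule refl)
  then have "(\<integral>\<^sup>+\<omega>. \<phi> (W (Suc m) i \<omega>) \<partial>M) = (\<integral>\<^sup>+\<omega>. ?F (\<lambda>p\<in>?P. \<xi> p \<omega>, \<lambda>p\<in>?Q. \<xi> p \<omega>) \<partial>M)"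
    unfolding F_eq by (intro nn_integral_cong arg_cong[of _ _ \<phi>])
  also have "\<dots> = (\<integral>\<^sup>+\<omega>. \<integral>\<^sup>+\<omega>'. ?F (\<lambda>p\<in>?P. \<xi> p \<omega>, \<lambda>p\<in>?Q. \<xi> p \<omega>') \<partial>M \<partial>M)"
    by (rule nn_integral_indep_split) fact+
  finally show ?thesis
    unfolding F_eq .
qed

lemma nn_integral_dominating_step_measurable:
  fixes \<phi> :: "nat \<Rightarrow> ennreal"
  shows "(\<lambda>\<omega>. \<integral>\<^sup>+\<omega>'. \<phi> (dominating_step a (\<lambda>j. W m j \<omega>) (\<lambda>j. N m j \<omega>) (\<lambda>_. \<xi> p \<omega>') i) \<partial>M) \<in> borel_measurable M"
proof -
  have "(\<lambda>z. dominating_step a (\<lambda>j. W m j (fst z)) (\<lambda>j. N m j (fst z)) (\<lambda>_. \<xi> p (snd z)) i)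
      \<in> M \<Otimes>\<^sub>M M \<rightarrow>\<^sub>M count_space UNIV"
    by (rule dominating_step_measurable; measurable)
  then have "(\<lambda>z. \<phi> (dominating_step a (\<lambda>j. W m j (fst z)) (\<lambda>j. N m j (fst z)) (\<lambda>_. \<xi> p (snd z)) i))
      \<in> borel_measurable (M \<Otimes>\<^sub>M M)"
    by (rule measurable_compose) simp
  then show ?thesis
    by (intro borel_measurable_nn_integral) (simp add: case_prod_beta')
qed

end

section \<open>Contraction of the exponential moment\<close>

context dominating_noise
begin

context
  fixes c :: real and x\<^sub>0 :: nat
  assumes c: "0 < c" and x0: "1 \<le> c * real x\<^sub>0"
begin

definition "exp_moment m = (\<integral>\<^sup>+\<omega>. ennreal (exp (c * real (W m 0 \<omega>))) \<partial>M)"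
text \<open>By \<open>mult_trunc_weight\<close> this is the exponential moment restricted to values
  at least \<open>x\<^sub>0\<close>, the part on which departures act in the estimate.\<close>

definition "tail_moment m = (\<integral>\<^sup>+\<omega>. ennreal (real (W m 0 \<omega>) * trunc_weight c x\<^sub>0 (W m 0 \<omega>)) \<partial>M)"

lemma tail_moment_le: "tail_moment m \<le> exp_moment m"
  unfolding tail_moment_def exp_moment_def
  by (intro nn_integral_mono ennreal_leI mult_trunc_weight_bounds[OF c x0])

lemma exp_moment_le: "exp_moment m \<le> tail_moment m + ennreal (exp (c * real x\<^sub>0))"
proof -
  have "exp_moment m \<le> (\<integral>\<^sup>+\<omega>. ennreal (real (W m 0 \<omega>) * trunc_weight c x\<^sub>0 (W m 0 \<omega>)) + ennreal (exp (c * real x\<^sub>0)) \<partial>M)"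
    unfolding exp_moment_def
  proof (rule nn_integral_mono)
    fix \<omega>
    let ?w = "W m 0 \<omega>"
    have "ennreal (exp (c * real ?w)) \<le> ennreal (real ?w * trunc_weight c x\<^sub>0 ?w + exp (c * real x\<^sub>0))"
      by (rule ennreal_leI) (rule mult_trunc_weight_bounds[OF c x0])
    also have "\<dots> = ennreal (real ?w * trunc_weight c x\<^sub>0 ?w) + ennreal (exp (c * real x\<^sub>0))"
      by (rule ennreal_plus) (auto simp: trunc_weight_def)
    finally show "ennreal (exp (c * real ?w)) \<le> ennreal (real ?w * trunc_weight c x\<^sub>0 ?w) + ennreal (exp (c * real x\<^sub>0))" .
  qed
  also have "\<dots> = tail_moment m + ennreal (exp (c * real x\<^sub>0))"
    unfolding tail_moment_def by (subst nn_integral_add) (auto simp: emeasure_space_1)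
  finally show ?thesis .
qed

text \<open>Queues at different sites are dependent. The tangent inequality decouples them: what
  remains is the primitive at \<open>W m i\<close> and at \<open>W m j\<close>, whose expectations
  agree by homogeneity and cancel.\<close>

lemma nn_integral_weight_W_le:
  assumes fin: "exp_moment m < \<infinity>"
  shows "(\<integral>\<^sup>+\<omega>. ennreal (trunc_weight c x\<^sub>0 (W m i \<omega>)) * ennreal (real (W m j \<omega>)) \<partial>M) \<le> tail_moment m"
proof -
  let ?u = "trunc_weight c x\<^sub>0" and ?U = "trunc_weight_sum c x\<^sub>0"
  let ?IU = "\<integral>\<^sup>+\<omega>. ennreal (?U (W m 0 \<omega>)) \<partial>M"
  have U: "(\<integral>\<^sup>+\<omega>. ennreal (?U (W m k \<omega>)) \<partial>M) = ?IU" for k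
    by (rule nn_integral_W_shift[of "\<lambda>x. ennreal (?U x)"])
  have T: "(\<integral>\<^sup>+\<omega>. ennreal (real (W m i \<omega>) * ?u (W m i \<omega>)) \<partial>M) = tail_moment m"
    unfolding tail_moment_def by (rule nn_integral_W_shift[of "\<lambda>x. ennreal (real x * ?u x)"])
  have "?IU \<le> tail_moment m"
    unfolding tail_moment_def by (intro nn_integral_mono ennreal_leI trunc_weight_sum_le[OF c x0])
  \<comment> \<open>Cancellation in \<open>ennreal\<close> requires a finite term.\<close>
  then have finU: "?IU \<noteq> \<top>"
    using le_less_trans[OF order_trans[OF _ tail_moment_le] fin] by fastforce
  have "(\<integral>\<^sup>+\<omega>. ennreal (?u (W m i \<omega>)) * ennreal (real (W m j \<omega>)) \<partial>M) + ?IU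
      = (\<integral>\<^sup>+\<omega>. ennreal (?u (W m i \<omega>)) * ennreal (real (W m j \<omega>)) + ennreal (?U (W m i \<omega>)) \<partial>M)"
    by (subst nn_integral_add) (auto simp: U[of i])
  also have "\<dots> \<le> (\<integral>\<^sup>+\<omega>. ennreal (real (W m i \<omega>) * ?u (W m i \<omega>)) + ennreal (?U (W m j \<omega>)) \<partial>M)"
  proof (rule nn_integral_mono)
    fix \<omega>
    let ?x = "W m i \<omega>" and ?y = "W m j \<omega>"
    have "ennreal (?u ?x * real ?y + ?U ?x) \<le> ennreal (real ?x * ?u ?x + ?U ?y)"
      by (rule ennreal_leI) (rule trunc_weight_young[OF c x0])
    moreover have "ennreal (?u ?x * real ?y + ?U ?x) = ennreal (?u ?x * real ?y) + ennreal (?U ?x)"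
      "ennreal (real ?x * ?u ?x + ?U ?y) = ennreal (real ?x * ?u ?x) + ennreal (?U ?y)"
      using trunc_weight_nonneg[OF c x0] trunc_weight_sum_nonneg[OF c x0]
      by (auto intro!: ennreal_plus mult_nonneg_nonneg)
    moreover have "ennreal (?u ?x * real ?y) = ennreal (?u ?x) * ennreal (real ?y)"
      by (rule ennreal_mult) (auto intro: trunc_weight_nonneg[OF c x0])
    ultimately show "ennreal (?u ?x) * ennreal (real ?y) + ennreal (?U ?x) \<le> ennreal (real ?x * ?u ?x) + ennreal (?U ?y)"
      by (simp only:)
  qed
  also have "\<dots> = tail_moment m + ?IU"
    by (subst nn_integral_add) (auto simp: U[of j] T)
  finally show ?thesis using finU by (simp add: ennreal_add_left_cancel_le add.commute)
qed

text \<open>The one-step bound is averaged over queue lengths and arrivals. In the interference sum,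
  \<open>nn_integral_weight_W_le\<close> handles the queue lengths and independence the arrivals.
  The gain from departures is added on the left, since subtraction in \<open>ennreal\<close> is
  truncated.\<close>

lemma exp_moment_Suc_le:
  assumes fin: "exp_moment m < \<infinity>"
  defines "b \<equiv> (1 - exp (- c)) / (1 + \<delta>)" and "g \<equiv> exp (\<mu> * (exp c - 1))"
  shows "exp_moment (Suc m) + ennreal (2 * b * \<delta> / sa) * tail_moment m
    \<le> ennreal g * exp_moment m + ennreal (b * \<delta> / sa * (1 + (g - 1) / c)) * tail_moment m"
proof -
  let ?u = "trunc_weight c x\<^sub>0"
  have b: "0 < b" unfolding b_def using c \<delta> by simp
  have g: "1 \<le> g" unfolding g_def using c \<mu> by simp
  let ?J = "\<lambda>\<omega>. \<integral>\<^sup>+j. ennreal (a j * (real (W m (0 - j) \<omega>) + real (N m (0 - j) \<omega>))) \<partial>count_space UNIV"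
  let ?f = "\<lambda>j \<omega>. ennreal (a j) * (ennreal (?u (W m 0 \<omega>)) * ennreal (real (W m (0 - j) \<omega>))
      + ennreal (?u (W m 0 \<omega>)) * ennreal (real (N m (0 - j) \<omega>)))"
  have split_J: "ennreal (a j * (real x + real y)) = ennreal (a j) * (ennreal (real x) + ennreal (real y))" for j x y
    by (simp only: ennreal_mult[OF a_nonneg add_nonneg_nonneg[OF of_nat_0_le_iff of_nat_0_le_iff]]
        ennreal_plus[OF of_nat_0_le_iff of_nat_0_le_iff])
  have J: "ennreal (?u (W m 0 \<omega>)) * ?J \<omega> = (\<integral>\<^sup>+j. ?f j \<omega> \<partial>count_space UNIV)" for \<omega>
    unfolding split_J
    by (subst nn_integral_cmult[symmetric]) (simp, intro nn_integral_cong, simp only: distrib_left mult_ac)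
  have u_int: "(\<integral>\<^sup>+\<omega>. ennreal (?u (W m 0 \<omega>)) \<partial>M) \<le> tail_moment m"
    unfolding tail_moment_def by (intro nn_integral_mono ennreal_leI mult_trunc_weight_bounds[OF c x0])
  have f_int: "(\<integral>\<^sup>+\<omega>. ?f j \<omega> \<partial>M) \<le> ennreal (a j) * (ennreal (1 + (g - 1) / c) * tail_moment m)" for j
  proof -
    have "(\<integral>\<^sup>+\<omega>. ennreal (?u (W m 0 \<omega>)) * ennreal (real (N m (0 - j) \<omega>)) \<partial>M)
        = (\<integral>\<^sup>+\<omega>. ennreal (?u (W m 0 \<omega>)) \<partial>M) * (\<integral>\<^sup>+\<omega>. ennreal (real (N m (0 - j) \<omega>)) \<partial>M)"
      by (rule nn_integral_W_N[of "\<lambda>x. ennreal (?u x)" m 0 "\<lambda>x. ennreal (real x)"])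
    also have "\<dots> \<le> tail_moment m * ennreal ((g - 1) / c)"
      unfolding g_def by (intro mult_mono u_int nn_integral_N_le c) auto
    finally have 1: "(\<integral>\<^sup>+\<omega>. ennreal (?u (W m 0 \<omega>)) * ennreal (real (N m (0 - j) \<omega>)) \<partial>M)
        \<le> tail_moment m * ennreal ((g - 1) / c)" .
    have "(\<integral>\<^sup>+\<omega>. ?f j \<omega> \<partial>M) = ennreal (a j) *
        ((\<integral>\<^sup>+\<omega>. ennreal (?u (W m 0 \<omega>)) * ennreal (real (W m (0 - j) \<omega>)) \<partial>M)
        + (\<integral>\<^sup>+\<omega>. ennreal (?u (W m 0 \<omega>)) * ennreal (real (N m (0 - j) \<omega>)) \<partial>M))"
      by (subst nn_integral_cmult) (auto simp: nn_integral_add)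
    also have "\<dots> \<le> ennreal (a j) * (tail_moment m + tail_moment m * ennreal ((g - 1) / c))"
      by (intro mult_left_mono add_mono nn_integral_weight_W_le 1 fin) auto
    also have "tail_moment m + tail_moment m * ennreal ((g - 1) / c) = ennreal (1 + (g - 1) / c) * tail_moment m"
    proof -
      have "ennreal (1 + (g - 1) / c) = 1 + ennreal ((g - 1) / c)"
        using g c by (subst ennreal_plus) auto
      then show ?thesis by (simp add: distrib_left mult.commute)
    qed
    finally show ?thesis .
  qed
  \<comment> \<open>Tonelli exchanges the sum over sites with the expectation. Summing
    \<open>a j\<close> gives one factor \<open>sa\<close>, which will cancel one of the two in
    \<open>sa\<^sup>2\<close>.\<close>
  have uJ: "(\<integral>\<^sup>+\<omega>. ennreal (?u (W m 0 \<omega>)) * ?J \<omega> \<partial>M) \<le> ennreal sa * (ennreal (1 + (g - 1) / c) * tail_moment m)"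
  proof -
    have "(\<integral>\<^sup>+\<omega>. ennreal (?u (W m 0 \<omega>)) * ?J \<omega> \<partial>M) = (\<integral>\<^sup>+j. \<integral>\<^sup>+\<omega>. ?f j \<omega> \<partial>M \<partial>count_space UNIV)"
      unfolding J by (rule nn_integral_count_space_nn_integral) auto
    also have "\<dots> \<le> (\<integral>\<^sup>+j. ennreal (a j) * (ennreal (1 + (g - 1) / c) * tail_moment m) \<partial>count_space UNIV)"
      by (intro nn_integral_mono f_int)
    also have "\<dots> = ennreal sa * (ennreal (1 + (g - 1) / c) * tail_moment m)"
      by (subst nn_integral_multc) (auto simp: nn_integral_a)
    finally show ?thesis .
  qed
  have J_meas [measurable]: "(\<lambda>\<omega>. ennreal (?u (W m 0 \<omega>)) * ?J \<omega>) \<in> borel_measurable M"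
  proof -
    have "(\<lambda>\<omega>. ?J \<omega>) \<in> borel_measurable M"
    proof -
      interpret sigma_finite_measure "count_space (UNIV :: (int ^ 'd) set)"
        by (rule sigma_finite_measure_count_space)
      have "(\<lambda>p. ennreal (a (snd p) * (real (W m (0 - snd p) (fst p)) + real (N m (0 - snd p) (fst p)))))
          \<in> borel_measurable (M \<Otimes>\<^sub>M count_space UNIV)"
        by (rule measurable_compose_countable[where
              f="\<lambda>j p. ennreal (a j * (real (W m (0 - j) (fst p)) + real (N m (0 - j) (fst p))))"]) measurable
      then show ?thesis
        by (intro borel_measurable_nn_integral) (simp add: case_prod_beta')
    qed
    then show ?thesis by measurable
  qed
  have "exp_moment (Suc m) + ennreal (2 * b * \<delta> / sa) * tail_moment m
      = (\<integral>\<^sup>+\<omega>. \<integral>\<^sup>+\<omega>'. ennreal (exp (c * real (dominating_step a (\<lambda>j. W m j \<omega>) (\<lambda>j. N m j \<omega>) (\<lambda>_. \<xi> (Inr 0, m) \<omega>') 0))) \<partial>M \<partial>M)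
        + (\<integral>\<^sup>+\<omega>. ennreal (2 * b * \<delta> / sa * (real (W m 0 \<omega>) * ?u (W m 0 \<omega>))) \<partial>M)"
  proof -
    have "ennreal (2 * b * \<delta> / sa) * tail_moment m
        = (\<integral>\<^sup>+\<omega>. ennreal (2 * b * \<delta> / sa) * ennreal (real (W m 0 \<omega>) * ?u (W m 0 \<omega>)) \<partial>M)"
      unfolding tail_moment_def by (rule nn_integral_cmult[symmetric]) measurable
    also have "\<dots> = (\<integral>\<^sup>+\<omega>. ennreal (2 * b * \<delta> / sa * (real (W m 0 \<omega>) * ?u (W m 0 \<omega>))) \<partial>M)"
      using b \<delta> sa_pos by (intro nn_integral_cong ennreal_mult[symmetric] mult_nonneg_nonneg
          trunc_weight_nonneg[OF c x0] divide_nonneg_pos) simp_all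
    finally show ?thesis
      unfolding exp_moment_def nn_integral_W_Suc[of "\<lambda>x. ennreal (exp (c * real x))" m 0] by (rule arg_cong)
  qed
  also have "\<dots> \<le> (\<integral>\<^sup>+\<omega>. (\<integral>\<^sup>+\<omega>'. ennreal (exp (c * real (dominating_step a (\<lambda>j. W m j \<omega>) (\<lambda>j. N m j \<omega>) (\<lambda>_. \<xi> (Inr 0, m) \<omega>') 0))) \<partial>M)
        + ennreal (2 * b * \<delta> / sa * (real (W m 0 \<omega>) * ?u (W m 0 \<omega>))) \<partial>M)"
    by (rule eq_refl, rule nn_integral_add[symmetric],
        rule nn_integral_dominating_step_measurable[of "\<lambda>x. ennreal (exp (c * real x))"]) measurable
  also have "\<dots> \<le> (\<integral>\<^sup>+\<omega>. ennreal (exp (c * (real (W m 0 \<omega>) + real (N m 0 \<omega>))))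
        + ennreal (b * \<delta> / sa\<^sup>2 * ?u (W m 0 \<omega>)) * ?J \<omega> \<partial>M)"
    unfolding b_def by (intro nn_integral_mono nn_integral_dominating_step c x0)
  also have "\<dots> = (\<integral>\<^sup>+\<omega>. ennreal (exp (c * real (W m 0 \<omega>))) * ennreal (exp (c * real (N m 0 \<omega>)))
        + ennreal (b * \<delta> / sa\<^sup>2) * (ennreal (?u (W m 0 \<omega>)) * ?J \<omega>) \<partial>M)"
  proof (rule nn_integral_cong)
    fix \<omega>
    have "ennreal (exp (c * (real (W m 0 \<omega>) + real (N m 0 \<omega>))))
        = ennreal (exp (c * real (W m 0 \<omega>))) * ennreal (exp (c * real (N m 0 \<omega>)))"
      by (simp only: distrib_left exp_add ennreal_mult[OF exp_ge_zero exp_ge_zero])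
    moreover have "ennreal (b * \<delta> / sa\<^sup>2 * ?u (W m 0 \<omega>)) = ennreal (b * \<delta> / sa\<^sup>2) * ennreal (?u (W m 0 \<omega>))"
      using b \<delta> by (intro ennreal_mult trunc_weight_nonneg[OF c x0]) simp
    ultimately show "ennreal (exp (c * (real (W m 0 \<omega>) + real (N m 0 \<omega>))))
        + ennreal (b * \<delta> / sa\<^sup>2 * ?u (W m 0 \<omega>)) * ?J \<omega>
        = ennreal (exp (c * real (W m 0 \<omega>))) * ennreal (exp (c * real (N m 0 \<omega>)))
        + ennreal (b * \<delta> / sa\<^sup>2) * (ennreal (?u (W m 0 \<omega>)) * ?J \<omega>)"
      by (simp only: mult.assoc)
  qed
  also have "\<dots> = (\<integral>\<^sup>+\<omega>. ennreal (exp (c * real (W m 0 \<omega>))) * ennreal (exp (c * real (N m 0 \<omega>))) \<partial>M)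
        + ennreal (b * \<delta> / sa\<^sup>2) * (\<integral>\<^sup>+\<omega>. ennreal (?u (W m 0 \<omega>)) * ?J \<omega> \<partial>M)"
    by (simp only: nn_integral_cmult[OF J_meas, symmetric]) (rule nn_integral_add; measurable)
  also have "(\<integral>\<^sup>+\<omega>. ennreal (exp (c * real (W m 0 \<omega>))) * ennreal (exp (c * real (N m 0 \<omega>))) \<partial>M) = exp_moment m * ennreal g"
    using nn_integral_W_N[of "\<lambda>x. ennreal (exp (c * real x))" m 0 "\<lambda>x. ennreal (exp (c * real x))" 0]
    unfolding exp_moment_def g_def nn_integral_N_exp .
  also have "exp_moment m * ennreal g + ennreal (b * \<delta> / sa\<^sup>2) * (\<integral>\<^sup>+\<omega>. ennreal (?u (W m 0 \<omega>)) * ?J \<omega> \<partial>M)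
      \<le> exp_moment m * ennreal g + ennreal (b * \<delta> / sa\<^sup>2) * (ennreal sa * (ennreal (1 + (g - 1) / c) * tail_moment m))"
    by (intro add_left_mono mult_left_mono uJ) auto
  also have "ennreal (b * \<delta> / sa\<^sup>2) * (ennreal sa * (ennreal (1 + (g - 1) / c) * tail_moment m))
      = ennreal (b * \<delta> / sa * (1 + (g - 1) / c)) * tail_moment m"
  proof -
    have "b * \<delta> / sa * (1 + (g - 1) / c) = b * \<delta> / sa\<^sup>2 * (sa * (1 + (g - 1) / c))"
      using sa_pos by (simp add: power2_eq_square)
    moreover have "0 \<le> b * \<delta> / sa\<^sup>2" "0 \<le> 1 + (g - 1) / c" using b \<delta> g c by auto
    ultimately show ?thesis
      using sa_pos by (simp only: ennreal_mult mult_nonneg_nonneg less_imp_le mult.assoc)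
  qed
  finally show ?thesis by (simp add: mult.commute)
qed

text \<open>With \<open>r\<close> the exponential and \<open>t\<close> the tail moment, the one-step
  bound reads \<open>r' <= g r - \<beta> (1 - \<nu>) t\<close>, and \<open>t >= r - K\<close> turns
  it into \<open>r' <= q r + \<beta> K\<close>. The larger of the initial value \<open>1\<close> and
  the fixed point \<open>\<beta> K / (1 - q)\<close> is preserved. The induction also supplies the
  finiteness that each step needs.\<close>

lemma exp_moment_bounded:
  defines "b \<equiv> (1 - exp (- c)) / (1 + \<delta>)" and "g \<equiv> exp (\<mu> * (exp c - 1))"
  assumes q: "g - b * \<delta> / sa * (1 - (g - 1) / c) \<le> q" "0 \<le> q" "q < 1" and g: "(g - 1) / c \<le> 1"
  shows "exp_moment m \<le> ennreal (max 1 (b * \<delta> / sa * exp (c * real x\<^sub>0) / (1 - q)))"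
proof -
  define \<beta> where "\<beta> = b * \<delta> / sa"
  define K where "K = exp (c * real x\<^sub>0)"
  define C where "C = max 1 (\<beta> * K / (1 - q))"
  define \<nu> where "\<nu> = (g - 1) / c"
  have b: "0 < b" unfolding b_def using c \<delta> by simp
  have \<beta>: "0 < \<beta>" unfolding \<beta>_def using b \<delta> sa_pos by simp
  have \<nu>: "0 \<le> \<nu>" "\<nu> \<le> 1" and g0: "0 \<le> g" using c \<mu> g unfolding \<nu>_def g_def by simp_all
  have C: "1 \<le> C" "\<beta> * K \<le> C * (1 - q)"
    using q by (auto simp: C_def max_def field_simps)
  have "exp_moment m \<le> ennreal C"
  proof (induction m)
    case 0
    then show ?case using C by (simp add: exp_moment_def emeasure_space_1)
  next
    case (Suc m)
    have fin: "exp_moment m < \<infinity>" using Suc by (simp add: le_less_trans)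
    then obtain r where r: "exp_moment m = ennreal r" "0 \<le> r"
      by (cases "exp_moment m") auto
    then obtain t where t: "tail_moment m = ennreal t" "0 \<le> t"
      using tail_moment_le[of m] by (cases "tail_moment m") (auto simp: top_unique)
    have step: "exp_moment (Suc m) + ennreal (2 * \<beta>) * ennreal t \<le> ennreal g * ennreal r + ennreal (\<beta> * (1 + \<nu>)) * ennreal t"
    proof -
      have "2 * \<beta> = 2 * ((1 - exp (- c)) / (1 + \<delta>)) * \<delta> / sa" by (simp add: \<beta>_def b_def)
      then show ?thesis
        using exp_moment_Suc_le[OF fin] unfolding r t unfolding \<beta>_def b_def g_def \<nu>_def by (simp only:)
    qed
    also have "\<dots> = ennreal (g * r + \<beta> * (1 + \<nu>) * t)"
      using g0 \<beta> \<nu> r t by (simp add: ennreal_plus ennreal_mult')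
    finally have step: "exp_moment (Suc m) + ennreal (2 * \<beta>) * ennreal t \<le> ennreal (g * r + \<beta> * (1 + \<nu>) * t)" .
    then obtain r' where r': "exp_moment (Suc m) = ennreal r'" "0 \<le> r'"
      by (cases "exp_moment (Suc m)") (auto simp: top_unique)
    have "ennreal (r' + 2 * \<beta> * t) \<le> ennreal (g * r + \<beta> * (1 + \<nu>) * t)"
      using step \<beta> r' t by (simp add: ennreal_plus ennreal_mult')
    then have "r' + 2 * \<beta> * t \<le> g * r + \<beta> * (1 + \<nu>) * t"
      using g0 \<beta> \<nu> r t by (subst (asm) ennreal_le_iff) auto
    then have 1: "r' \<le> g * r - \<beta> * (1 - \<nu>) * t" by (simp add: algebra_simps)
    have "ennreal r \<le> ennreal (t + K)"
      using exp_moment_le[of m] unfolding r t K_def[symmetric] using t by (simp add: K_def ennreal_plus)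
    then have "r - K \<le> t" using t by (subst (asm) ennreal_le_iff) (auto simp: K_def)
    \<comment> \<open>Here \<nu> \<le> 1 enters: the factor multiplying the inequality must be
      nonnegative.\<close>
    then have "\<beta> * (1 - \<nu>) * (r - K) \<le> \<beta> * (1 - \<nu>) * t"
      using \<beta> \<nu> by (intro mult_left_mono) auto
    with 1 have "r' \<le> (g - \<beta> * (1 - \<nu>)) * r + \<beta> * (1 - \<nu>) * K"
      by (simp add: algebra_simps)
    also have "\<dots> \<le> q * r + \<beta> * K"
    proof (intro add_mono mult_right_mono)
      show "\<beta> * (1 - \<nu>) \<le> \<beta>" using \<beta> \<nu> by (simp add: mult_left_le)
    qed (use q r in \<open>auto simp: \<beta>_def \<nu>_def K_def\<close>)
    also have "\<dots> \<le> q * C + C * (1 - q)"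
      using Suc q C r by (intro add_mono mult_left_mono) (auto simp: ennreal_le_iff)
    finally have "r' \<le> C" by (simp add: algebra_simps)
    then show ?case unfolding r' by (rule ennreal_leI)
  qed
  then show ?thesis by (simp add: C_def \<beta>_def K_def)
qed

end

end

text \<open>As a function of \<delta>, the contraction factor equals \<open>1\<close> at
  \<open>0\<close> and has derivative \<open>(1 - exp (- c)) * (lam * exp c - 1 / s)\<close> there,
  which is negative once \<open>lam * exp c < 1 / s\<close>. So \<open>c\<close> is fixed first and
  \<delta> is then taken small.\<close>

lemma exists_contracting_parameters:
  fixes lam s :: real
  assumes "0 < lam" "0 < s" "lam < 1 / s"
  shows "\<exists>c>0. \<exists>\<delta>>0. \<exists>q. 0 \<le> q \<and> q < 1 \<and>
    exp (lam * \<delta> * (exp c - 1)) - (1 - exp (- c)) / (1 + \<delta>) * \<delta> / s * (1 - (exp (lam * \<delta> * (exp c - 1)) - 1) / c) \<le> q \<and>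
    (exp (lam * \<delta> * (exp c - 1)) - 1) / c \<le> 1"
proof -
  \<comment> \<open>Half of the supremum of the admissible exponents:
    \<open>lam * exp c < 1 / s\<close> means \<open>c < ln (1 / (lam * s))\<close>.\<close>
  define c where "c = ln (1 / (lam * s)) / 2"
  have ls: "0 < lam * s" "lam * s < 1" using assms by (auto simp: field_simps)
  then have "1 < 1 / (lam * s)" by simp
  then have ln_pos: "0 < ln (1 / (lam * s))" by (rule ln_gt_zero)
  then have c: "0 < c" by (simp add: c_def)
  have "c < ln (1 / (lam * s))" using ln_pos by (simp add: c_def)
  then have "exp c < 1 / (lam * s)" using ls by (metis exp_less_mono exp_ln zero_less_divide_1_iff)
  then have lt: "lam * exp c < 1 / s" using assms by (simp add: field_simps)
  define f where "f \<delta> = exp (lam * \<delta> * (exp c - 1)) - (1 - exp (- c)) / (1 + \<delta>) * \<delta> / s * (1 - (exp (lam * \<delta> * (exp c - 1)) - 1) / c)" for \<delta>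
  have "(f has_real_derivative lam * (exp c - 1) - (1 - exp (- c)) / s) (at 0)"
    unfolding f_def using c assms by (auto intro!: derivative_eq_intros)
  moreover have "lam * (exp c - 1) - (1 - exp (- c)) / s < 0"
  proof -
    have "lam * (exp c - 1) - (1 - exp (- c)) / s = (1 - exp (- c)) * (lam * exp c - 1 / s)"
      using assms by (simp add: exp_minus field_simps)
    also have "\<dots> < 0" using c lt by (intro mult_pos_neg) auto
    finally show ?thesis .
  qed
  ultimately have "\<exists>d>0. \<forall>h>0. h < d \<longrightarrow> f (0 + h) < f 0"
    by (rule DERIV_neg_dec_right)
  then obtain d where d: "0 < d" "\<And>h. 0 < h \<Longrightarrow> h < d \<Longrightarrow> f h < f 0"
    by auto
  \<comment> \<open>The first entry keeps \<delta> strictly inside the range where \<open>f\<close>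
    lies below \<open>f 0 = 1\<close>; the second gives
    \<open>exp (lam * \<delta> * (exp c - 1)) <= 1 + c\<close>.\<close>
  define \<delta> where "\<delta> = min (d / 2) (ln (1 + c) / (lam * (exp c - 1)))"
  have e: "0 < lam * (exp c - 1)" using assms c by simp
  have \<delta>: "0 < \<delta>" using d c e by (simp add: \<delta>_def)
  have "\<delta> < d" using d unfolding \<delta>_def by linarith
  then have "f \<delta> < 1" using d(2)[OF \<delta>] by (simp add: f_def)
  moreover have "(exp (lam * \<delta> * (exp c - 1)) - 1) / c \<le> 1"
  proof -
    have "\<delta> * (lam * (exp c - 1)) \<le> ln (1 + c)"
      using e by (simp add: \<delta>_def min_le_iff_disj flip: pos_le_divide_eq)
    then have "exp (lam * \<delta> * (exp c - 1)) \<le> exp (ln (1 + c))"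
      by (simp add: mult_ac)
    then show ?thesis using c by simp
  qed
  ultimately show ?thesis
    using c \<delta> unfolding f_def by (intro exI[of _ c] conjI exI[of _ \<delta>] exI[of _ "max 0 (f \<delta>)"]) (auto simp: f_def)
qed

section \<open>The minimal stationary process\<close>

context driven
begin

lemma dominating_noise_grid:
  assumes "interference_sequence a" "0 < \<delta>"
  shows "dominating_noise M a (grid_noise A D t\<^sub>0 \<delta>) (lam * \<delta>) \<delta>"
proof unfold_locales
  show "0 < lam * \<delta>" using lam assms by simp
  show "indep_vars (\<lambda>_. borel) (grid_noise A D t\<^sub>0 \<delta>) UNIV"
    by (rule grid_noise_indep) fact
  show "distr M borel (grid_noise A D t\<^sub>0 \<delta> (map_sum f f k, m)) = distr M borel (grid_noise A D t\<^sub>0 \<delta> (k, m))" for f k m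
    by (rule grid_noise_shift_distr) fact
qed (simp_all only: assms grid_noise_Inl_distr prob_less_grid_noise_Inr)

text \<open>A level \<rho> \<le> 1 excludes the default value \<open>2\<close>, so a smallest mark
  below it comes from an actual atom.\<close>

lemma min_mark_D_witness:
  assumes "\<omega> \<in> space M" "\<rho> \<le> 1" "min_mark (D i \<omega>) s s' \<le> \<rho>"
  shows "\<exists>\<tau> v. (\<tau>, v) \<in> D i \<omega> \<and> s < \<tau> \<and> \<tau> \<le> s' \<and> v \<le> \<rho>"
proof -
  have "\<not> \<rho> < min_mark (D i \<omega>) s s'" "\<rho> < 2" using assms by auto
  then have "card (D i \<omega> \<inter> {s<..s'} \<times> {0..min \<rho> 1}) \<noteq> 0"
    using less_min_mark_D[OF assms(1), of \<rho> i s s'] by metis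
  then have "D i \<omega> \<inter> {s<..s'} \<times> {0..min \<rho> 1} \<noteq> {}"
    by (rule contrapos_nn) (simp only: card.empty)
  then obtain \<tau> v where "(\<tau>, v) \<in> D i \<omega> \<inter> {s<..s'} \<times> {0..min \<rho> 1}"
    by (metis ex_in_conv surj_pair)
  then have "(\<tau>, v) \<in> D i \<omega>" "s < \<tau>" "\<tau> \<le> s'" "v \<le> \<rho>" by simp_all
  then show ?thesis by blast
qed

lemma queue_le_dominating_chain:
  assumes a: "interference_sequence a" and \<delta>: "0 < \<delta>" and \<omega>: "\<omega> \<in> space M"
    and dyn: "queue_dynamics a (\<lambda>i. A i \<omega>) (\<lambda>i. D i \<omega>) t\<^sub>0 x" and init: "\<And>i. x i t\<^sub>0 = 0"
  shows "x i (t\<^sub>0 + real m * \<delta>) \<le> dominating_chain a (\<lambda>p. grid_noise A D t\<^sub>0 \<delta> p \<omega>) m i"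
proof (induction m arbitrary: i)
  case 0
  then show ?case by (simp add: init)
next
  case (Suc m)
  let ?s = "t\<^sub>0 + real m * \<delta>" and ?s' = "t\<^sub>0 + real (Suc m) * \<delta>"
  let ?e = "\<lambda>p. grid_noise A D t\<^sub>0 \<delta> p \<omega>"
  have "x i ?s' \<le> dominating_step a (dominating_chain a ?e m) (arr ?e m) (mark ?e m) i"
  proof (rule dominating_step_dominates[OF _ _ dyn])
    show "0 \<le> a j" for j using a unfolding interference_sequence_def by blast
    show "a 0 = 1" using a unfolding interference_sequence_def by blast
    show "t\<^sub>0 \<le> ?s" using \<delta> by simp
    show "?s \<le> ?s'" using \<delta> by (intro add_left_mono mult_right_mono) auto
    show "arr ?e m j = card (A j \<omega> \<inter> {?s<..?s'})" for j
      by (simp add: arr_def grid_noise_def Let_def)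
    show "\<exists>\<tau> v. (\<tau>, v) \<in> D i \<omega> \<and> ?s < \<tau> \<and> \<tau> \<le> ?s' \<and> v \<le> \<rho>"
      if "\<rho> \<le> 1" "mark ?e m i \<le> \<rho>" for \<rho>
      by (rule min_mark_D_witness[OF \<omega> that(1)]) (use that in \<open>simp add: mark_def grid_noise_def Let_def\<close>)
    show "finite (A j \<omega> \<inter> B)" if "bounded B" for j B by (rule finite_A[OF \<omega> that])
    show "finite (D j \<omega> \<inter> B)" if "bounded B" for j B by (rule finite_D[OF \<omega> that])
    show "D j \<omega> \<subseteq> UNIV \<times> {0..1}" for j by (rule D_subset[OF \<omega>])
    show "x j ?s \<le> dominating_chain a ?e m j" for j by (rule Suc.IH)
  qed
  then show ?case by simp
qed

text \<open>Uniformity in \<open>t\<^sub>0\<close> and \<open>m\<close> is what allows the starting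
  time to recede to minus infinity.\<close>

lemma dominating_chain_exp_moment_bounded:
  assumes a: "interference_sequence a" and small: "lam < 1 / infsum a UNIV"
  obtains c \<delta> C where "0 < c" "0 < \<delta>" "1 \<le> C"
    "\<And>t\<^sub>0 m i. (\<integral>\<^sup>+\<omega>. ennreal (exp (c * real (dominating_chain a (\<lambda>p. grid_noise A D t\<^sub>0 \<delta> p \<omega>) m i))) \<partial>M) \<le> ennreal C"
proof -
  \<comment> \<open>This instance with step length \<open>1\<close> provides \<open>sa_pos\<close>,
    which the choice of \<open>c\<close> and \<delta> presupposes.\<close>
  interpret one: dominating_noise M a "grid_noise A D 0 1" "lam * 1" 1
    by (rule dominating_noise_grid) (use a in auto)
  obtain c \<delta> q where c: "0 < c" and \<delta>: "0 < \<delta>" and q: "0 \<le> q" "q < 1"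
    "exp (lam * \<delta> * (exp c - 1)) - (1 - exp (- c)) / (1 + \<delta>) * \<delta> / one.sa * (1 - (exp (lam * \<delta> * (exp c - 1)) - 1) / c) \<le> q"
    "(exp (lam * \<delta> * (exp c - 1)) - 1) / c \<le> 1"
    using exists_contracting_parameters[OF lam one.sa_pos small] by blast
  obtain x\<^sub>0 :: nat where "1 / c < real x\<^sub>0" using reals_Archimedean2 by blast
  then have x0: "1 \<le> c * real x\<^sub>0" using c by (simp add: field_simps)
  define C where "C = max 1 ((1 - exp (- c)) / (1 + \<delta>) * \<delta> / one.sa * exp (c * real x\<^sub>0) / (1 - q))"
  show thesis
  proof (rule that[OF c \<delta>])
    show "1 \<le> C" by (simp add: C_def)
    fix t\<^sub>0 m and i :: "int ^ 'd"
    interpret dominating_noise M a "grid_noise A D t\<^sub>0 \<delta>" "lam * \<delta>" \<delta>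
      by (rule dominating_noise_grid) fact+
    have "exp_moment c m \<le> ennreal C"
      unfolding C_def by (rule exp_moment_bounded[OF c x0]) (use q in simp_all)
    then show "(\<integral>\<^sup>+\<omega>. ennreal (exp (c * real (W m i \<omega>))) \<partial>M) \<le> ennreal C"
      using nn_integral_W_shift[of "\<lambda>x. ennreal (exp (c * real x))" m i]
      unfolding exp_moment_def[OF c x0] by simp
  qed
qed

end

text \<open>For infinite \<open>x\<close> the eventual lower bounds hold for every \<open>n\<close>,
  and the limit inferior is infinite because \<open>exp (c n) >= 1 + c n\<close> exceeds any real.
  Thus almost sure finiteness of the limiting queue is a consequence of the moment bound.\<close>

lemma exp_enat_le_liminf:
  assumes "0 < c" and ev: "\<And>n. enat n \<le> x \<Longrightarrow> eventually (\<lambda>k. n \<le> f k) sequentially"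
  shows "exp_enat c x \<le> liminf (\<lambda>k. ennreal (exp (c * real (f k))))"
proof -
  have le: "ennreal (exp (c * real n)) \<le> liminf (\<lambda>k. ennreal (exp (c * real (f k))))" if "enat n \<le> x" for n
  proof (rule Liminf_bounded)
    show "eventually (\<lambda>k. ennreal (exp (c * real n)) \<le> ennreal (exp (c * real (f k)))) sequentially"
      using ev[OF that] by eventually_elim (use assms(1) in \<open>auto intro!: ennreal_leI\<close>)
  qed
  show ?thesis
  proof (cases x)
    case (enat n)
    then show ?thesis using le[of n] by (simp add: exp_enat_def)
  next
    case infinity
    have "liminf (\<lambda>k. ennreal (exp (c * real (f k)))) = \<top>"
    proof (rule ccontr)
      assume "liminf (\<lambda>k. ennreal (exp (c * real (f k)))) \<noteq> \<top>"
      then obtain r where r: "liminf (\<lambda>k. ennreal (exp (c * real (f k)))) = ennreal r" "0 \<le> r"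
        by (cases "liminf (\<lambda>k. ennreal (exp (c * real (f k))))") auto
      obtain n where n: "r / c < real n" using reals_Archimedean2 by blast
      have "exp (c * real n) \<le> r"
        using le[of n] r infinity by (simp add: ennreal_le_iff)
      moreover have "1 + c * real n \<le> exp (c * real n)" by (rule exp_ge_add_one_self)
      moreover have "r < c * real n" using n assms(1) by (simp add: field_simps)
      ultimately show False by linarith
    qed
    then show ?thesis by simp
  qed
qed

lemma exp_enat_mono: "c \<le> c' \<Longrightarrow> exp_enat c x \<le> exp_enat c' x"
  by (auto simp: exp_enat_def intro!: ennreal_leI mult_right_mono split: enat.split)

text \<open>In the extended naturals \<open>n <= y\<close> with \<open>n = Suc k\<close> is the open
  condition \<open>k < y\<close>, so it passes from the limit to eventual values.\<close>

lemma tendsto_enat_eventually_ge: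
  assumes "(f \<longlongrightarrow> x) F" "enat n \<le> x"
  shows "eventually (\<lambda>t. enat n \<le> f t) F"
proof (cases n)
  case (Suc k)
  have "enat k < x" using assms(2) Suc by (cases x) auto
  from order_tendstoD(1)[OF assms(1) this] show ?thesis
    by eventually_elim (simp add: Suc Suc_ile_eq)
qed (simp add: enat_0)

context driven
begin

lemma stationary_exp_moment_bounded:
  assumes a: "interference_sequence a" and small: "lam < 1 / infsum a UNIV"
    and X: "minimal_stationary_process M a A D X"
  obtains c C where "0 < c" "1 \<le> C" "\<And>i s. (\<integral>\<^sup>+\<omega>. exp_enat c (X i s \<omega>) \<partial>M) \<le> ennreal C"
proof -
  obtain Y where Y: "started_empty M a A D Y"
    and lim: "AE \<omega> in M. \<forall>i s. ((\<lambda>t. enat (Y t i s \<omega>)) \<longlongrightarrow> X i s \<omega>) at_top"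
    using X unfolding minimal_stationary_process_def by blast
  obtain c \<delta> C where c: "0 < c" and \<delta>: "0 < \<delta>" and C: "1 \<le> C"
    and bound: "\<And>t\<^sub>0 m i. (\<integral>\<^sup>+\<omega>. ennreal (exp (c * real (dominating_chain a (\<lambda>p. grid_noise A D t\<^sub>0 \<delta> p \<omega>) m i))) \<partial>M) \<le> ennreal C"
    using dominating_chain_exp_moment_bounded[OF a small] by blast
  show thesis
  proof (rule that[OF c C])
    fix i s
    \<comment> \<open>Starting at \<open>s - k * \<delta>\<close> makes \<open>s\<close> the
      \<open>k\<close>-th grid point. These chains are measurable, whereas no measurability is
      assumed of \<open>Y\<close>; hence the limit inferior is taken along them.\<close>
    define w where "w k \<omega> = dominating_chain a (\<lambda>p. grid_noise A D (s - real k * \<delta>) \<delta> p \<omega>) k i" for k \<omega>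
    have meas: "w k \<in> M \<rightarrow>\<^sub>M count_space UNIV" for k
    proof -
      interpret dominating_noise M a "grid_noise A D (s - real k * \<delta>) \<delta>" "lam * \<delta>" \<delta>
        by (rule dominating_noise_grid) fact+
      show ?thesis unfolding w_def[abs_def] by (rule W_measurable)
    qed
    have t: "filterlim (\<lambda>k. real k * \<delta> - s) at_top sequentially"
    proof -
      have "filterlim (\<lambda>k. \<delta> * real k) at_top sequentially"
        by (rule filterlim_tendsto_pos_mult_at_top[OF tendsto_const \<delta> filterlim_real_sequentially])
      from filterlim_tendsto_add_at_top[OF tendsto_const[of "- s"] this] show ?thesis
        by (simp add: algebra_simps)
    qed
    have "AE \<omega> in M. exp_enat c (X i s \<omega>) \<le> liminf (\<lambda>k. ennreal (exp (c * real (w k \<omega>))))"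
      using Y[unfolded started_empty_def] lim AE_space
    proof eventually_elim
      case (elim \<omega>)
      show ?case
      proof (rule exp_enat_le_liminf[OF c])
        fix n assume "enat n \<le> X i s \<omega>"
        with elim(2) have "eventually (\<lambda>t. enat n \<le> enat (Y t i s \<omega>)) at_top"
          by (intro tendsto_enat_eventually_ge) auto
        \<comment> \<open>\<open>started_empty\<close> speaks about \<open>t >= 0\<close>, which
          holds for all late \<open>k\<close>.\<close>
        then have "eventually (\<lambda>t. enat n \<le> enat (Y t i s \<omega>) \<and> 0 \<le> t) at_top"
          by (rule eventually_conj[OF _ eventually_ge_at_top])
        from filterlim_iff[THEN iffD1, OF t, rule_format, OF this]
        show "eventually (\<lambda>k. n \<le> w k \<omega>) sequentially"
        proof eventually_elim
          fix k assume k: "enat n \<le> enat (Y (real k * \<delta> - s) i s \<omega>) \<and> 0 \<le> real k * \<delta> - s"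
          have "Y (real k * \<delta> - s) i (- (real k * \<delta> - s) + real k * \<delta>) \<omega>
              \<le> dominating_chain a (\<lambda>p. grid_noise A D (- (real k * \<delta> - s)) \<delta> p \<omega>) k i"
            using elim(1)[rule_format, of "real k * \<delta> - s"] k
            by (intro queue_le_dominating_chain[OF a \<delta> elim(3)]) auto
          then have "Y (real k * \<delta> - s) i s \<omega> \<le> w k \<omega>"
            by (simp add: w_def)
          with k show "n \<le> w k \<omega>" by simp
        qed
      qed
    qed
    then have "(\<integral>\<^sup>+\<omega>. exp_enat c (X i s \<omega>) \<partial>M) \<le> (\<integral>\<^sup>+\<omega>. liminf (\<lambda>k. ennreal (exp (c * real (w k \<omega>)))) \<partial>M)"
      by (rule nn_integral_mono_AE)
    also have "\<dots> \<le> liminf (\<lambda>k. \<integral>\<^sup>+\<omega>. ennreal (exp (c * real (w k \<omega>))) \<partial>M)"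
      by (rule nn_integral_liminf) (rule measurable_compose[OF meas], simp)
    also have "\<dots> \<le> ennreal C"
      by (rule Liminf_le) (auto simp: w_def bound)
    finally show "(\<integral>\<^sup>+\<omega>. exp_enat c (X i s \<omega>) \<partial>M) \<le> ennreal C" .
  qed
qed

lemma prob_stationary_ge_lower:
  assumes X: "minimal_stationary_process M a A D X" and n: "0 < n"
  shows "exp (- (1 + 1 / lam) * real n) \<le> prob {\<omega> \<in> space M. enat n \<le> X i s \<omega>}"
proof -
  obtain Y where Y: "started_empty M a A D Y"
    and lim: "AE \<omega> in M. \<forall>i s. ((\<lambda>t. enat (Y t i s \<omega>)) \<longlongrightarrow> X i s \<omega>) at_top"
    and meas: "X i s \<in> M \<rightarrow>\<^sub>M count_space UNIV"
    using X unfolding minimal_stationary_process_def by blast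
  \<comment> \<open>On a window of length \<open>n / lam\<close> the expected number of arrivals is
    \<open>n\<close>, so exactly \<open>n\<close> arrivals have probability
    \<open>exp (- n) * n ^ n / fact n\<close>, at least \<open>exp (- n)\<close>.\<close>
  define p where "p = s - real n / lam"
  have p: "p < s" "s - p = real n / lam" using n lam by (auto simp: p_def)
  define EA where "EA = {\<omega> \<in> space M. card (A i \<omega> \<inter> {p<..s}) = n}"
  \<comment> \<open>Without atoms there is no departure whatever the rates are, so the event
    involves only the driving process at \<open>i\<close>.\<close>
  define ED where "ED = {\<omega> \<in> space M. card (D i \<omega> \<inter> {p<..s} \<times> {0..1}) = 0}"
  have EA: "EA \<in> point_process_events M (arrival_intensity lam) (A i)"
    unfolding point_process_events_def EA_def using sets_A by (intro sigma_sets.Basic) blast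
  have ED: "ED \<in> point_process_events M departure_intensity (D i)"
    unfolding point_process_events_def ED_def using sets_D[OF less_imp_le[OF p(1)] order_refl]
    by (intro sigma_sets.Basic) blast
  let ?E = "case_sum (\<lambda>_. EA) (\<lambda>_. ED)"
  have "prob (\<Inter>k\<in>{Inl i, Inr i}. ?E k) = (\<Prod>k\<in>{Inl i, Inr i}. prob (?E k))"
    by (rule indep_setsD[OF indep_AD]) (use EA ED in auto)
  then have indep: "prob (EA \<inter> ED) = prob EA * prob ED" by simp
  have "measure (arrival_intensity lam) {p<..s} = real n"
    using p lam by (simp add: measure_arrival_intensity)
  then have "prob EA = exp (- real n) * (real n ^ n / fact n)"
    unfolding EA_def using poisson_point_process_prob_card(2)[OF ppA sets_A, of i p s n] by simp
  moreover have "1 \<le> real n ^ n / fact n"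
    using fact_le_power[of n, where ?'a=real] by simp
  ultimately have 1: "exp (- real n) \<le> prob EA"
    using mult_left_mono[of 1 "real n ^ n / fact n" "exp (- real n)"] by simp
  have "prob ED = exp (- (real n / lam))"
    unfolding ED_def
    using poisson_point_process_prob_card(2)[OF ppD sets_D[OF less_imp_le[OF p(1)] order_refl], of i 0]
      measure_departure_intensity(2)[OF less_imp_le[OF p(1)] order_refl] p by simp
  then have "exp (- (1 + 1 / lam) * real n) = exp (- real n) * prob ED"
    by (simp add: algebra_simps flip: exp_add)
  also have "\<dots> \<le> prob (EA \<inter> ED)"
    unfolding indep using 1 by (intro mult_right_mono) auto
  also have "\<dots> \<le> prob {\<omega> \<in> space M. enat n \<le> X i s \<omega>}"
  proof (rule finite_measure_mono_AE)
    have "X i s -` {enat n..} \<inter> space M \<in> events"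
      using meas by (rule measurable_sets) simp
    then show "{\<omega> \<in> space M. enat n \<le> X i s \<omega>} \<in> events"
      by (simp add: vimage_def Int_def conj_commute)
    show "AE \<omega> in M. \<omega> \<in> EA \<inter> ED \<longrightarrow> \<omega> \<in> {\<omega> \<in> space M. enat n \<le> X i s \<omega>}"
      using Y[unfolded started_empty_def] lim AE_space
    proof eventually_elim
      case (elim \<omega>)
      show ?case
      proof
        assume E: "\<omega> \<in> EA \<inter> ED"
        \<comment> \<open>Whatever the queue length at time \<open>p\<close>, it has grown by
          \<open>n\<close> at time \<open>s\<close>. The bound holds for all starting times
          \<open>- t\<close> up to \<open>p\<close> and therefore passes to the limit.\<close>
        have "n \<le> Y t i s \<omega>" if t: "max 0 (- p) \<le> t" for t
        proof -
          let ?acc = "{(\<tau>, u) \<in> D i \<omega>. p < \<tau> \<and> \<tau> \<le> s \<and> u \<le> departure_rate a (left_limits (\<lambda>i s. Y t i s \<omega>) \<tau>) i}"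
          have fin: "finite (D i \<omega> \<inter> {p<..s} \<times> {0..1})"
            by (rule finite_D[OF elim(3)]) (auto intro: bounded_Times)
          then have "D i \<omega> \<inter> {p<..s} \<times> {0..1} = {}" using E by (simp add: ED_def)
          moreover have "?acc \<subseteq> D i \<omega> \<inter> {p<..s} \<times> {0..1}" using D_subset[OF elim(3), of i] by auto
          ultimately have "card ?acc = 0" by (simp only: subset_empty card.empty)
          moreover have "{\<tau> \<in> A i \<omega>. p < \<tau> \<and> \<tau> \<le> s} = A i \<omega> \<inter> {p<..s}" by auto
          moreover have "Y t i s \<omega> + card ?acc = Y t i p \<omega> + card {\<tau> \<in> A i \<omega>. p < \<tau> \<and> \<tau> \<le> s}"
            using elim(1)[rule_format, of t] t p
            by (intro queue_dynamics_increment[where t\<^sub>0="- t" and A="\<lambda>i. A i \<omega>" and D="\<lambda>i. D i \<omega>"]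
                finite_A[OF elim(3)] finite_D[OF elim(3)] D_subset[OF elim(3)]) auto
          ultimately show ?thesis using E by (simp add: EA_def)
        qed
        then have "eventually (\<lambda>t. enat n \<le> enat (Y t i s \<omega>)) at_top"
          by (intro eventually_at_top_linorderI[of "max 0 (- p)"]) simp
        then have "enat n \<le> X i s \<omega>"
          by (rule tendsto_lowerbound[OF elim(2)[rule_format] _ trivial_limit_at_top_linorder])
        with elim(3) show "\<omega> \<in> {\<omega> \<in> space M. enat n \<le> X i s \<omega>}" by simp
      qed
    qed
  qed
  finally show ?thesis .
qed

end

section \<open>Exponential moments and tails of the stationary queues\<close>

theorem theorem2p1:
  fixes a :: "int ^ 'd::finite \<Rightarrow> real"
    and M :: "'w measure"
    and lam :: real
    and A :: "int ^ 'd \<Rightarrow> 'w \<Rightarrow> real set"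
    and D :: "int ^ 'd \<Rightarrow> 'w \<Rightarrow> (real \<times> real) set"
    and X :: "int ^ 'd \<Rightarrow> real \<Rightarrow> 'w \<Rightarrow> enat"
  assumes "interference_sequence a"
    and "0 < lam"
    and "lam < 1 / (\<Sum>\<^sub>\<infinity>j. a j)"
    and "driving_processes M lam A D"
    and "minimal_stationary_process M a A D X"
  shows "(\<exists>c\<^sub>0>0. \<forall>c. 0 \<le> c \<and> c < c\<^sub>0 \<longrightarrow>
            (\<forall>i t. (\<integral>\<^sup>+ \<omega>. exp_enat c (X i t \<omega>) \<partial>M) < \<infinity>)) \<and>
         (\<exists>c\<^sub>1>0. \<exists>c\<^sub>2>0. \<exists>x\<^sub>0>0. \<forall>x\<ge>x\<^sub>0. \<forall>i t.
            exp (- c\<^sub>1 * x) \<le> measure M {\<omega> \<in> space M. ereal x \<le> ereal_of_enat (X i t \<omega>)} \<and>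
            measure M {\<omega> \<in> space M. ereal x \<le> ereal_of_enat (X i t \<omega>)} \<le> exp (- c\<^sub>2 * x))"
proof -
  interpret prob_space M
    using assms(4) unfolding driving_processes_def by blast
  interpret driven M lam A D
    by unfold_locales fact+
  obtain c C where c: "0 < c" and C: "1 \<le> C"
    and bound: "\<And>i s. (\<integral>\<^sup>+\<omega>. exp_enat c (X i s \<omega>) \<partial>M) \<le> ennreal C"
    using stationary_exp_moment_bounded[OF assms(1,3,5)] by blast
  let ?T = "\<lambda>x i t. {\<omega> \<in> space M. ereal x \<le> ereal_of_enat (X i t \<omega>)}"
  have meas: "X i t \<in> M \<rightarrow>\<^sub>M count_space UNIV" for i t
    using assms(5) unfolding minimal_stationary_process_def by blast
  have T_event: "?T x i t \<in> events" for x i t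
  proof -
    have "X i t -` {n. ereal x \<le> ereal_of_enat n} \<inter> space M \<in> events"
      using meas by (rule measurable_sets) simp
    then show ?thesis by (simp add: vimage_def Int_def conj_commute)
  qed
  \<comment> \<open>Markov's inequality for the exponential; an infinite queue length belongs to the
    event, and \<open>exp_enat\<close> is infinite there.\<close>
  have markov: "prob (?T x i t) \<le> C * exp (- c * x)" for x i t
  proof -
    have "ennreal (exp (c * x)) * emeasure M (?T x i t) = (\<integral>\<^sup>+\<omega>. ennreal (exp (c * x)) * indicator (?T x i t) \<omega> \<partial>M)"
      by (rule nn_integral_cmult_indicator[symmetric]) (rule T_event)
    also have "\<dots> \<le> (\<integral>\<^sup>+\<omega>. exp_enat c (X i t \<omega>) \<partial>M)"
    proof (rule nn_integral_mono)
      fix \<omega>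
      have "ennreal (exp (c * x)) \<le> exp_enat c (X i t \<omega>)" if "ereal x \<le> ereal_of_enat (X i t \<omega>)"
        using that c by (cases "X i t \<omega>") (auto simp: exp_enat_def intro!: ennreal_leI)
      then show "ennreal (exp (c * x)) * indicator (?T x i t) \<omega> \<le> exp_enat c (X i t \<omega>)"
        by (auto split: split_indicator)
    qed
    also have "\<dots> \<le> ennreal C" by (rule bound)
    finally have "ennreal (exp (c * x) * prob (?T x i t)) \<le> ennreal C"
      unfolding emeasure_eq_measure by (simp add: ennreal_mult)
    then have "exp (c * x) * prob (?T x i t) \<le> C" using C by (simp add: ennreal_le_iff)
    then show ?thesis by (simp add: exp_minus field_simps)
  qed
  \<comment> \<open>The exponent \<open>c\<close> of the uniform bound serves as
    \<open>c\<^sub>0\<close>; smaller exponents follow by monotonicity.\<close>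
  have part1: "\<exists>c\<^sub>0>0. \<forall>c. 0 \<le> c \<and> c < c\<^sub>0 \<longrightarrow> (\<forall>i t. (\<integral>\<^sup>+ \<omega>. exp_enat c (X i t \<omega>) \<partial>M) < \<infinity>)"
  proof (intro exI[of _ c] conjI allI impI c)
    fix c' i t assume c': "0 \<le> c' \<and> c' < c"
    have "(\<integral>\<^sup>+ \<omega>. exp_enat c' (X i t \<omega>) \<partial>M) \<le> (\<integral>\<^sup>+ \<omega>. exp_enat c (X i t \<omega>) \<partial>M)"
      using c' by (intro nn_integral_mono exp_enat_mono) simp
    also have "\<dots> \<le> ennreal C" by (rule bound)
    also have "\<dots> < \<infinity>" by simp
    finally show "(\<integral>\<^sup>+ \<omega>. exp_enat c' (X i t \<omega>) \<partial>M) < \<infinity>" .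
  qed
  \<comment> \<open>The factor \<open>2\<close> absorbs rounding: the ceiling of \<open>x\<close> is
    at most \<open>2 * x\<close> for \<open>x >= 1\<close>.\<close>
  define c\<^sub>1 where "c\<^sub>1 = 2 * (1 + 1 / lam)"
  \<comment> \<open>The entry \<open>1\<close> serves the rounding in the lower bound. From
    \<open>2 * ln C / c\<close> on, half of the exponent absorbs the constant \<open>C\<close> of
    \<open>markov\<close>, leaving the rate \<open>c / 2\<close>.\<close>
  define x\<^sub>0 where "x\<^sub>0 = max 1 (2 * ln C / c)"
  have c1: "0 < c\<^sub>1" using assms(2) by (simp add: c\<^sub>1_def add_pos_pos)
  have lower: "exp (- c\<^sub>1 * x) \<le> prob (?T x i t)" if x: "x\<^sub>0 \<le> x" for x i t
  proof -
    define n where "n = nat \<lceil>x\<rceil>"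
    have x1: "1 \<le> x" using x by (simp add: x\<^sub>0_def)
    have n: "x \<le> real n" "real n \<le> 2 * x" "0 < n"
      using x1 unfolding n_def by linarith+
    have "(1 + 1 / lam) * real n \<le> (1 + 1 / lam) * (2 * x)"
      using n assms(2) by (intro mult_left_mono) (auto simp: add_nonneg_nonneg)
    then have "exp (- c\<^sub>1 * x) \<le> exp (- (1 + 1 / lam) * real n)"
      by (simp add: c\<^sub>1_def algebra_simps)
    also have "\<dots> \<le> prob {\<omega> \<in> space M. enat n \<le> X i t \<omega>}"
      by (rule prob_stationary_ge_lower[OF assms(5) n(3)])
    also have "\<dots> \<le> prob (?T x i t)"
    proof (rule finite_measure_mono[OF _ T_event])
      have "ereal x \<le> ereal_of_enat m" if "enat n \<le> m" for m
        using that n(1) by (cases m) auto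
      then show "{\<omega> \<in> space M. enat n \<le> X i t \<omega>} \<subseteq> ?T x i t" by auto
    qed
    finally show ?thesis .
  qed
  have upper: "prob (?T x i t) \<le> exp (- (c / 2) * x)" if x: "x\<^sub>0 \<le> x" for x i t
  proof -
    have "2 * ln C / c \<le> x" using x by (simp add: x\<^sub>0_def)
    then have "ln C \<le> c / 2 * x" using c by (simp add: field_simps)
    then have "C \<le> exp (c / 2 * x)" using C by (metis exp_le_cancel_iff exp_ln less_le_trans zero_less_one)
    then have "C * exp (- c * x) \<le> exp (c / 2 * x) * exp (- c * x)"
      by (intro mult_right_mono) auto
    also have "\<dots> = exp (- (c / 2) * x)" by (simp add: algebra_simps flip: exp_add)
    finally show ?thesis using markov[of x i t] by linarith
  qed
  have "0 < c / 2" "0 < x\<^sub>0" using c by (auto simp: x\<^sub>0_def)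
  with c1 lower upper show ?thesis
    by (intro conjI[OF part1] exI[of _ c\<^sub>1] exI[of _ "c / 2"] exI[of _ x\<^sub>0] conjI allI impI)
qed

end
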